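(* Let $r\ge2$, let $m=(m_{i,j})_{1\le i<j\le r+1}$ be positive integers, $M=\sum_{1\le i<j\le r+1}m_{i,j}$, $M_1=\sum_{i=2}^{r+1}m_{1,i}$, $h=\big(\sum_{2\le i<j\le r+1}m_{i,j}\big)-(r-1)$, and $m'=(m_{i,j})_{2\le i<j\le r+1}$. With $\partial_i=\partial/\partial a_i$, define for $q\ge1$ the differential operator $$D_q=\sum_{k\ge1}\ \sum_{\substack{2\le i_1<\cdots<i_k\le r\\ p_1+\cdots+p_k=q,\ p_l\ge1}}\Big(\prod_{l=1}^k\binom{m_{1,i_l}}{p_l}\Big)\partial_{i_1}^{p_1}\cdots\partial_{i_k}^{p_k},$$ (equivalently, $D_q$ is the coefficient of $t^q$ in $\prod_{i=2}^r(1+t\partial_i)^{m_{1,i}}$), and define $P_0=1$ and recursively $P_k=\sum_{q=1}^{k}(-1)^{q+1}D_qP_{k-q}$ for $k\ge1$ (so $P_1=D_1$, $P_2=D_1^2-D_2$, $P_3=D_1^3-2D_1D_2+D_3$). Then, with $a=\sum_{i=1}^r a_i(e_i-e_{r+1})$ and $a'=\sum_{i=2}^r a_i(e_i-e_{r+1})$, $$v_{A_r^+,m,\mathfrak{c}_{\rm nice}}(a)=\sum_{k=0}^{h}\frac{a_1^{M_1-1+k}}{(M_1-1+k)!}\,P_k\,v_{A_{r-1}^+,m',\mathfrak{c}'_{\rm nice}}(a'),$$ where the last summand has $M_1-1+h=M-r$.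
   Context: For $n\ge1$, positive integer multiplicities $\mu=(\mu_{i,j})$ indexed by the positive roots $\{e_i-e_j: i<j\}$ of type $A_n$ (here indexed on $\{1,\dots,r+1\}$ for $m$ and on $\{2,\dots,r+1\}$ for $m'$), and a point $b=\sum_i b_i(e_i-e_{\text{last}})$ with $b_i\ge0$, the flow polytope is the set of $(y_{i,j,k})$, $1\le k\le\mu_{i,j}$, with $y_{i,j,k}\ge0$ and $\sum_{i<j}\sum_k y_{i,j,k}(e_i-e_j)=b$. Its volume is taken with respect to the quotient measure $du/db$ on the fibre over $b$ of the linear map sending coordinate $y_{i,j,k}$ to $e_i-e_j$, where $du$ is Lebesgue measure and $db$ is the Lebesgue measure on the sum-zero hyperplane normalized by the lattice generated by the roots. The nice chamber is the set of such $b$ with all $b_i>0$; $v_{A_r^+,m,\mathfrak{c}_{\rm nice}}(a)$ denotes the polynomial in $a_1,\dots,a_r$ (homogeneous of degree $M-r$) coinciding with the volume on the closure of the nice chamber of $A_r^+$ (roots $e_i-e_j$, $1\le i<j\le r+1$), and $v_{A_{r-1}^+,m',\mathfrak{c}'_{\rm nice}}(a')$ the analogous polynomial in $a_2,\dots,a_r$ for the roots $e_i-e_j$, $2\le i<j\le r+1$, with multiplicities $m'$. *)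

theory Defs
  imports "HOL-Analysis.Analysis"
begin

subsection \<open>Flow polytopes of type A\<close>

text \<open>
  Everything is stated for the positive roots \<open>e\<^sub>i - e\<^sub>j\<close>, \<open>s \<le> i < j \<le> n\<close>, on the vertex set
  \<open>{s..n}\<close>; they span a root system of type A of rank \<open>n - s\<close>.  Vectors of the ambient space
  are functions \<open>nat \<Rightarrow> real\<close> that vanish off \<open>{s..n}\<close>.
  A multiplicity function \<open>\<mu>\<close> is only ever evaluated at pairs in \<open>pos_roots s n\<close>, so that
  restricting \<open>m\<close> to the roots on \<open>{2..r+1}\<close> amounts to taking \<open>s = 2\<close>.
\<close>

definition pos_roots :: "nat \<Rightarrow> nat \<Rightarrow> (nat \<times> nat) set" where
  "pos_roots s n = {(i, j). s \<le> i \<and> i < j \<and> j \<le> n}"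

definition root_vec :: "nat \<Rightarrow> nat \<Rightarrow> nat \<Rightarrow> real" where
  "root_vec i j = (\<lambda>v. of_bool (v = i) - of_bool (v = j))"

definition root_space :: "nat \<Rightarrow> nat \<Rightarrow> (nat \<Rightarrow> real) set" where
  "root_space s n = {b. (\<forall>v. v \<notin> {s..n} \<longrightarrow> b v = 0) \<and> (\<Sum>v\<in>{s..n}. b v) = 0}"

definition point :: "nat \<Rightarrow> nat \<Rightarrow> (nat \<Rightarrow> real) \<Rightarrow> nat \<Rightarrow> real" where
  "point s n a = (\<lambda>v. \<Sum>i\<in>{s..<n}. a i * root_vec i n v)"

text \<open>
  The vectors \<open>e\<^sub>i - e\<^sub>n\<close>, \<open>s \<le> i < n\<close>, are a \<open>\<int>\<close>-basis of the lattice generated by the roots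
  (\<open>e\<^sub>i - e\<^sub>j = (e\<^sub>i - e\<^sub>n) - (e\<^sub>j - e\<^sub>n)\<close>), so the Lebesgue measure on the sum-zero hyperplane giving
  that lattice covolume 1 is the standard Lebesgue measure in the coordinates of this basis.
\<close>

definition root_space_measure :: "nat \<Rightarrow> nat \<Rightarrow> (nat \<Rightarrow> real) measure" where
  "root_space_measure s n = distr (\<Pi>\<^sub>M i\<in>{s..<n}. lborel) borel (point s n)"

definition flow_index :: "nat \<Rightarrow> nat \<Rightarrow> (nat \<Rightarrow> nat \<Rightarrow> nat) \<Rightarrow> (nat \<times> nat \<times> nat) set" where
  "flow_index s n \<mu> = {(i, j, k). (i, j) \<in> pos_roots s n \<and> 1 \<le> k \<and> k \<le> \<mu> i j}"

definition flow_measure ::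
    "nat \<Rightarrow> nat \<Rightarrow> (nat \<Rightarrow> nat \<Rightarrow> nat) \<Rightarrow> (nat \<times> nat \<times> nat \<Rightarrow> real) measure" where
  "flow_measure s n \<mu> = (\<Pi>\<^sub>M t\<in>flow_index s n \<mu>. lborel)"

definition flow_map ::
    "nat \<Rightarrow> nat \<Rightarrow> (nat \<Rightarrow> nat \<Rightarrow> nat) \<Rightarrow> (nat \<times> nat \<times> nat \<Rightarrow> real) \<Rightarrow> nat \<Rightarrow> real" where
  "flow_map s n \<mu> y = (\<lambda>v. \<Sum>(i, j, k)\<in>flow_index s n \<mu>. y (i, j, k) * root_vec i j v)"

definition flow_fibre ::
    "nat \<Rightarrow> nat \<Rightarrow> (nat \<Rightarrow> nat \<Rightarrow> nat) \<Rightarrow> (nat \<Rightarrow> real) \<Rightarrow> (nat \<times> nat \<times> nat \<Rightarrow> real) set" where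
  "flow_fibre s n \<mu> b = {y \<in> flow_index s n \<mu> \<rightarrow>\<^sub>E UNIV. flow_map s n \<mu> y = b}"

definition flow_polytope ::
    "nat \<Rightarrow> nat \<Rightarrow> (nat \<Rightarrow> nat \<Rightarrow> nat) \<Rightarrow> (nat \<Rightarrow> real) \<Rightarrow> (nat \<times> nat \<times> nat \<Rightarrow> real) set" where
  "flow_polytope s n \<mu> b = {y \<in> flow_fibre s n \<mu> b. \<forall>t\<in>flow_index s n \<mu>. 0 \<le> y t}"

text \<open>
  The quotient measure \<open>du/db\<close>: a family of measures \<open>\<nu> b\<close> carried by the fibres over \<open>b\<close>,
  translation invariant (the fibres are parallel affine spaces), and disintegrating \<open>du\<close> along
  \<open>db\<close>.  When all multiplicities are positive these conditions determine \<open>\<nu> b\<close> uniquely for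
  every \<open>b\<close> in the sum-zero hyperplane; the values of \<open>\<nu>\<close> off the hyperplane are irrelevant.
\<close>

definition is_quotient_measure ::
    "nat \<Rightarrow> nat \<Rightarrow> (nat \<Rightarrow> nat \<Rightarrow> nat) \<Rightarrow>
     ((nat \<Rightarrow> real) \<Rightarrow> (nat \<times> nat \<times> nat \<Rightarrow> real) measure) \<Rightarrow> bool" where
  "is_quotient_measure s n \<mu> \<nu> \<longleftrightarrow>
     (\<forall>b\<in>root_space s n.
        sets (\<nu> b) = sets (flow_measure s n \<mu>) \<and>
        emeasure (\<nu> b) (space (flow_measure s n \<mu>) - flow_fibre s n \<mu> b) = 0) \<and>
     (\<forall>b\<in>root_space s n. \<forall>u.
        \<nu> (\<lambda>v. b v + flow_map s n \<mu> u v) =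
          distr (\<nu> b) (flow_measure s n \<mu>) (\<lambda>y. \<lambda>t\<in>flow_index s n \<mu>. y t + u t)) \<and>
     (\<forall>A\<in>sets (flow_measure s n \<mu>).
        (\<lambda>b. emeasure (\<nu> b) A) \<in> borel_measurable (root_space_measure s n) \<and>
        emeasure (flow_measure s n \<mu>) A =
          (\<integral>\<^sup>+ b. emeasure (\<nu> b) A \<partial>root_space_measure s n))"

definition quotient_measure ::
    "nat \<Rightarrow> nat \<Rightarrow> (nat \<Rightarrow> nat \<Rightarrow> nat) \<Rightarrow> (nat \<Rightarrow> real) \<Rightarrow> (nat \<times> nat \<times> nat \<Rightarrow> real) measure" where
  "quotient_measure s n \<mu> = (SOME \<nu>. is_quotient_measure s n \<mu> \<nu>)"

definition flow_volume :: "nat \<Rightarrow> nat \<Rightarrow> (nat \<Rightarrow> nat \<Rightarrow> nat) \<Rightarrow> (nat \<Rightarrow> real) \<Rightarrow> real" where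
  "flow_volume s n \<mu> b = measure (quotient_measure s n \<mu> b) (flow_polytope s n \<mu> b)"

subsection \<open>The volume polynomial of the nice chamber\<close>

definition nice_chamber :: "nat \<Rightarrow> nat \<Rightarrow> (nat \<Rightarrow> real) set" where
  "nice_chamber s n = {point s n a | a. \<forall>i\<in>{s..<n}. 0 < a i}"

text \<open>
  Polynomials in the variables \<open>a\<^sub>i\<close>, \<open>i \<in> V\<close>, are represented by their polynomial functions on
  \<open>nat \<Rightarrow> real\<close>, which do not depend on the coordinates outside \<open>V\<close>.
\<close>

definition homogeneous_poly :: "nat set \<Rightarrow> nat \<Rightarrow> ((nat \<Rightarrow> real) \<Rightarrow> real) \<Rightarrow> bool" where
  "homogeneous_poly V d p \<longleftrightarrow>
     (\<exists>c :: (nat \<Rightarrow> nat) \<Rightarrow> real. \<forall>a.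
        p a = (\<Sum>e\<in>{e \<in> V \<rightarrow>\<^sub>E {..d}. (\<Sum>i\<in>V. e i) = d}. c e * (\<Prod>i\<in>V. a i ^ e i)))"

definition nice_volume_poly ::
    "nat \<Rightarrow> nat \<Rightarrow> (nat \<Rightarrow> nat \<Rightarrow> nat) \<Rightarrow> (nat \<Rightarrow> real) \<Rightarrow> real" where
  "nice_volume_poly s n \<mu> =
     (THE p. homogeneous_poly {s..<n} ((\<Sum>(i, j)\<in>pos_roots s n. \<mu> i j) - (n - s)) p \<and>
             (\<forall>a. point s n a \<in> closure (nice_chamber s n) \<longrightarrow>
                  p a = flow_volume s n \<mu> (point s n a)))"

subsection \<open>The differential operators\<close>

definition pderiv_at :: "nat \<Rightarrow> ((nat \<Rightarrow> real) \<Rightarrow> real) \<Rightarrow> (nat \<Rightarrow> real) \<Rightarrow> real" where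
  "pderiv_at i f = (\<lambda>a. deriv (\<lambda>t. f (a(i := t))) (a i))"

text \<open>
  Pairs \<open>([i\<^sub>1, \<dots>, i\<^sub>k], [p\<^sub>1, \<dots>, p\<^sub>k])\<close> with \<open>k \<ge> 1\<close>, \<open>2 \<le> i\<^sub>1 < \<dots> < i\<^sub>k \<le> r\<close>, all \<open>p\<^sub>l \<ge> 1\<close> and
  \<open>p\<^sub>1 + \<dots> + p\<^sub>k = q\<close>.
\<close>

definition D_index :: "nat \<Rightarrow> nat \<Rightarrow> (nat list \<times> nat list) set" where
  "D_index r q =
     {(is, ps). is \<noteq> [] \<and> sorted_wrt (<) is \<and> set is \<subseteq> {2..r} \<and>
                length ps = length is \<and> (\<forall>p\<in>set ps. 1 \<le> p) \<and> sum_list ps = q}"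

definition D_op ::
    "nat \<Rightarrow> (nat \<Rightarrow> nat \<Rightarrow> nat) \<Rightarrow> nat \<Rightarrow> ((nat \<Rightarrow> real) \<Rightarrow> real) \<Rightarrow> (nat \<Rightarrow> real) \<Rightarrow> real" where
  "D_op r m q f =
     (\<lambda>a. \<Sum>(is, ps)\<in>D_index r q.
        real (\<Prod>(i, p)\<leftarrow>zip is ps. m 1 i choose p) *
        foldr (\<lambda>(i, p). pderiv_at i ^^ p) (zip is ps) f a)"

fun P_op ::
    "nat \<Rightarrow> (nat \<Rightarrow> nat \<Rightarrow> nat) \<Rightarrow> nat \<Rightarrow> ((nat \<Rightarrow> real) \<Rightarrow> real) \<Rightarrow> (nat \<Rightarrow> real) \<Rightarrow> real" where
  "P_op r m 0 f = f"
| "P_op r m (Suc k) f =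
     (\<lambda>a. \<Sum>q = 1..Suc k. (-1) ^ (q + 1) * D_op r m q (P_op r m (Suc k - q) f) a)"

end

theory Submission imports Defs
begin

text \<open>
  Start from the edges \<open>(l, n, 1)\<close>, one from every vertex \<open>l\<close> to the last vertex \<open>n\<close>, and insert
  the remaining edges one at a time, in decreasing order of their source.  At every stage the
  netflow map pushes Lebesgue measure on the nonnegative orthant forward to a measure with a
  density, and on the nice chamber this density is a polynomial: inserting an edge from \<open>v\<close> to \<open>j\<close>
  turns \<open>p\<close> into \<open>\<integral>\<^sub>0\<^bsup>a\<^sub>v\<^esup> p (a - t (e\<^sub>v - e\<^sub>j)) dt\<close>, because no edge present so far enters \<open>v\<close>, so that
  the density vanishes for \<open>a\<^sub>v < 0\<close>.  For the first vertex the polynomials have the form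
  \<open>\<Sum>\<^sub>k a\<^sub>1\<^bsup>N+k\<^esup> / (N+k)! Q\<^sub>k p'\<close> with \<open>p'\<close> the volume polynomial of the smaller graph.  By Taylor
  expansion and the Beta integral, an edge from \<open>1\<close> to \<open>j\<close> raises \<open>N\<close> by one and multiplies
  \<open>\<Sum>\<^sub>k Q\<^sub>k t\<^sup>k\<close> by \<open>1 / (1 - t \<partial>\<^sub>j)\<close> (by \<open>1\<close> if \<open>j = n\<close>).  So \<open>Q\<^sub>k\<close> is the complete homogeneous symmetric
  function of the \<open>\<partial>\<^sub>j\<close>, and its relation to the elementary ones \<open>D\<^sub>q\<close> is the recursion defining \<open>P\<^sub>k\<close>.
\<close>

subsection \<open>Polynomial functions\<close>

text \<open>Two inductive notions serve different ends. \<open>poly_fun\<close> carries neither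
  degree nor variable set and suffices for the calculus of derivatives; \<open>hom_poly\<close>
  below tracks both. The coefficient form \<open>homogeneous_poly\<close> is needed only where
  \<open>nice_volume_poly\<close> is unfolded, and agrees with \<open>hom_poly\<close> for finite
  \<open>V\<close>.\<close>

inductive poly_fun :: "((nat \<Rightarrow> real) \<Rightarrow> real) \<Rightarrow> bool" where
  const: "poly_fun (\<lambda>a. c)"
| mult: "poly_fun f \<Longrightarrow> poly_fun (\<lambda>a. a i * f a)"
| add: "poly_fun f \<Longrightarrow> poly_fun g \<Longrightarrow> poly_fun (\<lambda>a. f a + g a)"

inductive hom_poly :: "nat set \<Rightarrow> nat \<Rightarrow> ((nat \<Rightarrow> real) \<Rightarrow> real) \<Rightarrow> bool" for V where
  zero: "hom_poly V d (\<lambda>a. 0)"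
| const: "hom_poly V 0 (\<lambda>a. c)"
| mult: "i \<in> V \<Longrightarrow> hom_poly V d f \<Longrightarrow> hom_poly V (Suc d) (\<lambda>a. a i * f a)"
| add: "hom_poly V d f \<Longrightarrow> hom_poly V d g \<Longrightarrow> hom_poly V d (\<lambda>a. f a + g a)"

lemma hom_poly_imp_poly_fun: "hom_poly V d f \<Longrightarrow> poly_fun f"
  by (induction rule: hom_poly.induct) (auto intro: poly_fun.intros)

lemma poly_fun_scale: "poly_fun f \<Longrightarrow> poly_fun (\<lambda>a. c * f a)"
proof (induction rule: poly_fun.induct)
  case (mult f i)
  from poly_fun.mult[OF mult.IH, of i] show ?case by (simp add: mult_ac)
next
  case (add f g)
  from poly_fun.add[OF add.IH] show ?case by (simp add: distrib_left)
qed (rule poly_fun.const)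

lemma poly_fun_sum: "(\<And>x. x \<in> S \<Longrightarrow> poly_fun (f x)) \<Longrightarrow> poly_fun (\<lambda>a. \<Sum>x\<in>S. f x a)"
  by (induction S rule: infinite_finite_induct) (auto intro: poly_fun.intros)

lemma hom_poly_scale: "hom_poly V d f \<Longrightarrow> hom_poly V d (\<lambda>a. c * f a)"
proof (induction rule: hom_poly.induct)
  case (zero d)
  then show ?case by (simp add: hom_poly.zero)
next
  case (mult i d f)
  from hom_poly.mult[OF mult.hyps(1) mult.IH] show ?case by (simp add: mult_ac)
next
  case (add d f g)
  from hom_poly.add[OF add.IH] show ?case by (simp add: distrib_left)
qed (rule hom_poly.const)

lemma hom_poly_sum:
  "(\<And>x. x \<in> S \<Longrightarrow> hom_poly V d (f x)) \<Longrightarrow> hom_poly V d (\<lambda>a. \<Sum>x\<in>S. f x a)"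
  by (induction S rule: infinite_finite_induct) (auto intro: hom_poly.intros)

lemma hom_poly_power_mult:
  "i \<in> V \<Longrightarrow> hom_poly V d f \<Longrightarrow> hom_poly V (e + d) (\<lambda>a. a i ^ e * f a)"
  by (induction e) (auto dest: hom_poly.mult simp: mult.assoc)

lemma hom_poly_mono: "hom_poly V d f \<Longrightarrow> V \<subseteq> W \<Longrightarrow> hom_poly W d f"
  by (induction rule: hom_poly.induct) (auto intro: hom_poly.intros)

lemma hom_poly_cong_arg: "hom_poly V d f \<Longrightarrow> (\<And>i. i \<in> V \<Longrightarrow> a i = b i) \<Longrightarrow> f a = f b"
  by (induction rule: hom_poly.induct) auto

lemma hom_poly_0: "hom_poly V 0 f \<Longrightarrow> \<exists>c. f = (\<lambda>a. c)"
proof (induction "0::nat" f rule: hom_poly.induct)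
  case (add f g)
  then obtain c d where "f = (\<lambda>a. c)" "g = (\<lambda>a. d)" by blast
  then show ?case by auto
qed auto

lemma homogeneous_poly_add:
  assumes "homogeneous_poly V d f" "homogeneous_poly V d g"
  shows "homogeneous_poly V d (\<lambda>a. f a + g a)"
proof -
  obtain c1 c2 where
    "\<And>a. f a = (\<Sum>e\<in>{e \<in> V \<rightarrow>\<^sub>E {..d}. (\<Sum>i\<in>V. e i) = d}. c1 e * (\<Prod>i\<in>V. a i ^ e i))"
    "\<And>a. g a = (\<Sum>e\<in>{e \<in> V \<rightarrow>\<^sub>E {..d}. (\<Sum>i\<in>V. e i) = d}. c2 e * (\<Prod>i\<in>V. a i ^ e i))"
    using assms unfolding homogeneous_poly_def by blast
  then show ?thesis unfolding homogeneous_poly_def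
    by (intro exI[of _ "\<lambda>e. c1 e + c2 e"]) (simp add: sum.distrib distrib_right)
qed

text \<open>Raising the exponent of \<open>i\<close> by one maps the exponent vectors of degree
  \<open>d\<close> bijectively onto those of degree \<open>Suc d\<close> with positive entry at
  \<open>i\<close>. The new coefficients \<open>c'\<close> are the old ones transported along this
  bijection, and 0 on the remaining vectors.\<close>

lemma homogeneous_poly_mult:
  assumes "finite V" "i \<in> V" "homogeneous_poly V d f"
  shows "homogeneous_poly V (Suc d) (\<lambda>a. a i * f a)"
proof -
  define E where "E k = {e \<in> V \<rightarrow>\<^sub>E {..k}. (\<Sum>i\<in>V. e i) = k}" for k :: nat
  have finE: "finite (E k)" for k
    unfolding E_def by (intro finite_Collect_conjI disjI1) (use assms in \<open>auto intro!: finite_PiE\<close>)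
  obtain c where c: "\<And>a. f a = (\<Sum>e\<in>E d. c e * (\<Prod>i\<in>V. a i ^ e i))"
    using assms(3) unfolding homogeneous_poly_def E_def by blast
  have sum_split: "(\<Sum>j\<in>V. e j) = e i + (\<Sum>j\<in>V-{i}. e j)" for e :: "nat \<Rightarrow> nat"
    using assms by (simp add: sum.remove)
  have sum_upd: "(\<Sum>j\<in>V-{i}. (e(i := x)) j) = (\<Sum>j\<in>V-{i}. e j)" for e :: "nat \<Rightarrow> nat" and x
    by (intro sum.cong) auto
  have prod_upd: "(\<Prod>j\<in>V. a j ^ (e(i := Suc (e i))) j) = a i * (\<Prod>j\<in>V. a j ^ e j)"
    for a :: "nat \<Rightarrow> real" and e
  proof -
    have "(\<Prod>j\<in>V-{i}. a j ^ (e(i := Suc (e i))) j) = (\<Prod>j\<in>V-{i}. a j ^ e j)"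
      by (intro prod.cong) auto
    then show ?thesis using assms by (simp add: prod.remove[of V i])
  qed
  define c' where "c' e = (if e i = 0 then 0 else c (e(i := e i - 1)))" for e :: "nat \<Rightarrow> nat"
  have "a i * f a = (\<Sum>e\<in>E (Suc d). c' e * (\<Prod>i\<in>V. a i ^ e i))" for a
  proof -
    have "a i * f a = (\<Sum>e\<in>E d. c e * (\<Prod>j\<in>V. a j ^ (e(i := Suc (e i))) j))"
      unfolding c sum_distrib_left prod_upd by (simp add: mult_ac)
    also have "\<dots> = (\<Sum>e\<in>{e\<in>E (Suc d). e i \<noteq> 0}. c' e * (\<Prod>i\<in>V. a i ^ e i))"
    proof (rule sum.reindex_bij_witness[where j = "\<lambda>e. e(i := Suc (e i))" and i = "\<lambda>e. e(i := e i - 1)"])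
      fix e assume e: "e \<in> E d"
      then show "e(i := Suc (e i)) \<in> {e \<in> E (Suc d). e i \<noteq> 0}"
        using assms(2) unfolding E_def
        by (auto simp: PiE_iff extensional_def sum_split sum_upd simp del: fun_upd_apply) 
          (auto simp: le_Suc_eq le_less)
    next
      fix e assume e: "e \<in> {e \<in> E (Suc d). e i \<noteq> 0}"
      \<comment> \<open>The exponents other than \<open>e i\<close> must respect the smaller bound
        \<open>d\<close>; they do because \<open>e i\<close> already uses up at least one unit of
        the total \<open>Suc d\<close>.\<close>
      have le: "e j \<le> d" if "j \<in> V" "j \<noteq> i" for j
      proof -
        have "e j \<le> (\<Sum>j\<in>V-{i}. e j)" using that assms(1) by (intro member_le_sum) auto
        then show ?thesis using e sum_split[of e] by (auto simp: E_def)
      qed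
      from e le show "e(i := e i - 1) \<in> E d"
        using assms(2) unfolding E_def
        by (auto simp: PiE_iff extensional_def sum_split sum_upd simp del: fun_upd_apply) auto
    qed (auto simp: c'_def)
    also have "\<dots> = (\<Sum>e\<in>E (Suc d). c' e * (\<Prod>i\<in>V. a i ^ e i))"
      by (intro sum.mono_neutral_left) (auto simp: finE c'_def)
    finally show ?thesis .
  qed
  then show ?thesis unfolding homogeneous_poly_def E_def by blast
qed

lemma hom_poly_imp_homogeneous:
  assumes "finite V" "hom_poly V d f"
  shows "homogeneous_poly V d f"
  using assms(2)
proof (induction rule: hom_poly.induct)
  case (zero d)
  then show ?case unfolding homogeneous_poly_def by (intro exI[of _ "\<lambda>_. 0"]) simp
next
  case (const c)
  have "{e \<in> V \<rightarrow>\<^sub>E {..0}. (\<Sum>i\<in>V. e i) = 0} = {\<lambda>i\<in>V. 0 :: nat}"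
    by (auto simp: PiE_iff extensional_def fun_eq_iff)
  then show ?case unfolding homogeneous_poly_def by (intro exI[of _ "\<lambda>_. c"]) simp
qed (auto intro: homogeneous_poly_add homogeneous_poly_mult assms)

lemma homogeneous_imp_hom_poly:
  assumes "finite V" "homogeneous_poly V d f"
  shows "hom_poly V d f"
proof -
  obtain c where c: "f = (\<lambda>a. \<Sum>e\<in>{e \<in> V \<rightarrow>\<^sub>E {..d}. (\<Sum>i\<in>V. e i) = d}. c e * (\<Prod>i\<in>V. a i ^ e i))"
    using assms(2) unfolding homogeneous_poly_def by blast
  have "hom_poly V (\<Sum>i\<in>W. e i) (\<lambda>a. \<Prod>i\<in>W. a i ^ e i)" if "W \<subseteq> V" for W and e :: "nat \<Rightarrow> nat"
    using finite_subset[OF that assms(1)] that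
    by (induction rule: finite_induct) (auto intro: hom_poly.const hom_poly_power_mult)
  then show ?thesis unfolding c by (intro hom_poly_sum hom_poly_scale) auto
qed

text \<open>Fixing all variables but one yields a genuine univariate \<open>poly\<close>, which
  makes finiteness of roots and differentiability available.\<close>

lemma poly_fun_section:
  assumes "poly_fun f"
  shows "\<exists>p. \<forall>t. f (a(i := t)) = poly p t"
  using assms
proof (induction rule: poly_fun.induct)
  case (const c)
  show ?case by (intro exI[of _ "[:c:]"]) simp
next
  case (mult f j)
  then obtain p where "\<forall>t. f (a(i := t)) = poly p t" by blast
  then show ?case
    by (intro exI[of _ "(if j = i then [:0, 1:] else [:a j:]) * p"])
      (simp del: fun_upd_apply, simp)
next
  case (add f g)
  then obtain p q where "\<forall>t. f (a(i := t)) = poly p t" "\<forall>t. g (a(i := t)) = poly q t" by blast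
  then show ?case by (intro exI[of _ "p + q"]) (simp del: fun_upd_apply)
qed

text \<open>The sign constraints are dropped one variable at a time: in each variable the section is
  a univariate polynomial with the infinitely many roots of a half-line. This yields uniqueness of
  the volume polynomial.\<close>

lemma poly_fun_eq_0:
  assumes "poly_fun f" "finite V" "\<And>a. (\<And>i. i \<in> V \<Longrightarrow> 0 \<le> a i) \<Longrightarrow> f a = 0"
  shows "f a = 0"
proof -
  \<comment> \<open>\<open>W\<close> collects the variables whose sign is already
    unrestricted.\<close>
  have "\<forall>a. (\<forall>i\<in>V - W. 0 \<le> a i) \<longrightarrow> f a = 0" if "W \<subseteq> V" for W
    using finite_subset[OF that assms(2)] that
  proof (induction rule: finite_induct)
    case empty
    then show ?case using assms(3) by auto
  next
    case (insert i W)
    show ?case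
    proof (intro allI impI)
      fix a :: "nat \<Rightarrow> real" assume a: "\<forall>j\<in>V - insert i W. 0 \<le> a j"
      obtain p where p: "\<And>t. f (a(i := t)) = poly p t"
        using poly_fun_section[OF assms(1)] by blast
      have "poly p t = 0" if "0 \<le> t" for t
        unfolding p[symmetric] using insert a that by auto
      then have "{0..} \<subseteq> {t. poly p t = 0}" by auto
      moreover have "infinite {0::real..}" by (simp add: infinite_Ici)
      ultimately have "p = 0" using finite_subset poly_roots_finite by blast
      then show "f a = 0" using p[of "a i"] by simp
    qed
  qed
  from this[of V] show ?thesis by simp
qed

section \<open>Partial derivatives of polynomial functions\<close>

lemma poly_fun_DERIV:
  assumes "poly_fun f"
  shows "((\<lambda>t. f (a(i := t))) has_real_derivative pderiv_at i f (a(i := t))) (at t)"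
proof -
  obtain p where p: "\<And>t. f (a(i := t)) = poly p t"
    using poly_fun_section[OF assms] by blast
  then have "((\<lambda>t. f (a(i := t))) has_real_derivative poly (pderiv p) t) (at t)"
    by (simp add: poly_DERIV)
  then show ?thesis
    by (simp add: pderiv_at_def DERIV_imp_deriv)
qed

lemma pderiv_at_const: "pderiv_at i (\<lambda>a. c) = (\<lambda>a. 0)"
  by (simp add: pderiv_at_def)

lemma pderiv_at_eqI:
  "(\<And>a. ((\<lambda>t. f (a(i := t))) has_real_derivative g a) (at (a i))) \<Longrightarrow> pderiv_at i f = g"
  by (auto simp: pderiv_at_def DERIV_imp_deriv)

lemma poly_fun_DERIV_self: 
  "poly_fun f \<Longrightarrow> ((\<lambda>t. f (a(i := t))) has_real_derivative pderiv_at i f a) (at (a i))"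
  using poly_fun_DERIV[of f a i "a i"] by simp

lemma pderiv_at_add:
  "poly_fun f \<Longrightarrow> poly_fun g \<Longrightarrow>
    pderiv_at i (\<lambda>a. f a + g a) = (\<lambda>a. pderiv_at i f a + pderiv_at i g a)"
  by (intro pderiv_at_eqI DERIV_add poly_fun_DERIV_self)

lemma pderiv_at_scale:
  "poly_fun f \<Longrightarrow> pderiv_at i (\<lambda>a. c * f a) = (\<lambda>a. c * pderiv_at i f a)"
  by (intro pderiv_at_eqI DERIV_cmult poly_fun_DERIV_self)

lemma pderiv_at_mult:
  assumes "poly_fun f"
  shows "pderiv_at i (\<lambda>a. a j * f a) = (\<lambda>a. of_bool (j = i) * f a + a j * pderiv_at i f a)"
proof (rule pderiv_at_eqI)
  fix a :: "nat \<Rightarrow> real"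
  have "((\<lambda>t. (a(i := t)) j) has_real_derivative of_bool (j = i)) (at (a i))"
    by (cases "j = i") auto
  moreover have "((\<lambda>t. f (a(i := t))) has_real_derivative pderiv_at i f a) (at (a i))"
    by (rule poly_fun_DERIV_self[OF assms])
  ultimately have "((\<lambda>t. (a(i := t)) j * f (a(i := t))) has_real_derivative
      of_bool (j = i) * f (a(i := a i)) + pderiv_at i f a * (a(i := a i)) j) (at (a i))"
    by (rule DERIV_mult)
  then show "((\<lambda>t. (a(i := t)) j * f (a(i := t))) has_real_derivative
          of_bool (j = i) * f a + a j * pderiv_at i f a) (at (a i))"
    by (simp add: mult_ac del: fun_upd_apply)
qed

lemma poly_fun_pderiv_at: "poly_fun f \<Longrightarrow> poly_fun (pderiv_at i f)"
proof (induction rule: poly_fun.induct)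
  case (const c)
  then show ?case by (simp add: pderiv_at_const poly_fun.const)
next
  case (mult f j)
  then show ?case by (simp add: pderiv_at_mult poly_fun.intros poly_fun_scale)
next
  case (add f g)
  then show ?case by (simp add: pderiv_at_add poly_fun.intros)
qed

lemma pderiv_at_sum:
  "(\<And>x. x \<in> S \<Longrightarrow> poly_fun (f x)) \<Longrightarrow>
    pderiv_at i (\<lambda>a. \<Sum>x\<in>S. f x a) = (\<lambda>a. \<Sum>x\<in>S. pderiv_at i (f x) a)"
  by (induction S rule: infinite_finite_induct)
    (auto simp: pderiv_at_const pderiv_at_add poly_fun_sum)

text \<open>For polynomial functions the symmetry of mixed derivatives is an algebraic fact:
  induction on the construction reduces it to the product rule with a coordinate.\<close>

lemma pderiv_at_commute:
  "poly_fun f \<Longrightarrow> pderiv_at i (pderiv_at j f) = pderiv_at j (pderiv_at i f)"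
proof (induction rule: poly_fun.induct)
  case (const c)
  then show ?case by (simp add: pderiv_at_const)
next
  case (mult f k)
  then show ?case
    by (simp add: pderiv_at_mult pderiv_at_add poly_fun_pderiv_at poly_fun.mult poly_fun_scale
        pderiv_at_scale fun_eq_iff)
next
  case (add f g)
  then show ?case by (simp add: pderiv_at_add poly_fun_pderiv_at)
qed

lemma hom_poly_pderiv_at: "hom_poly V d f \<Longrightarrow> hom_poly V (d - 1) (pderiv_at i f)"
proof (induction rule: hom_poly.induct)
  case (mult j d f)
  have "hom_poly V d (\<lambda>a. a j * pderiv_at i f a)"
  \<comment> \<open>For \<open>d = 0\<close> the product of a coordinate with something of degree
    \<open>d - 1 = 0\<close> would be assigned degree 1 instead of \<open>d\<close>. There
    \<open>f\<close> is constant, so the term is zero, which has every degree.\<close>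
  proof (cases d)
    case 0
    then obtain c where "f = (\<lambda>a. c)" using mult.hyps hom_poly_0 by blast
    then show ?thesis by (simp add: pderiv_at_const hom_poly.zero)
  next
    case (Suc d')
    then show ?thesis using hom_poly.mult[OF mult.hyps(1) mult.IH] by simp
  qed
  then show ?case using mult
    by (simp add: pderiv_at_mult hom_poly_imp_poly_fun hom_poly.add hom_poly_scale)
next
  case (add d f g)
  then show ?case by (simp add: pderiv_at_add hom_poly_imp_poly_fun hom_poly.add)
qed (auto simp: pderiv_at_const hom_poly.zero)

lemma hom_poly_pderiv_at_iter: "hom_poly V d f \<Longrightarrow> hom_poly V (d - k) ((pderiv_at i ^^ k) f)"
proof (induction k)
  case (Suc k)
  then show ?case using hom_poly_pderiv_at[of V "d - k" _ i] by simp
qed auto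

lemma hom_poly_pderiv_at_iter_eq_0:
  assumes "hom_poly V d f" "d < k"
  shows "(pderiv_at i ^^ k) f = (\<lambda>a. 0)"
proof -
  have z: "(pderiv_at i ^^ l) (\<lambda>a. 0) = (\<lambda>a. 0)" for l
    by (induction l) (auto simp: pderiv_at_const)
  obtain c where "(pderiv_at i ^^ d) f = (\<lambda>a. c)"
    using hom_poly_0 hom_poly_pderiv_at_iter[OF assms(1), of d i] by fastforce
  then have "(pderiv_at i ^^ Suc d) f = (\<lambda>a. 0)" by (simp add: pderiv_at_const)
  then have "(pderiv_at i ^^ (k - Suc d)) ((pderiv_at i ^^ Suc d) f) = (\<lambda>a. 0)"
    by (simp only: z)
  then show ?thesis using assms(2) by (metis Suc_leI comp_apply funpow_add le_add_diff_inverse2)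
qed

text \<open>In the Maclaurin formula with remainder along the \<open>j\<close> direction, the
  remainder contains a derivative of order \<open>d + 1\<close>, which vanishes.\<close>

lemma hom_poly_taylor:
  assumes "hom_poly V d f"
  shows "f (a(j := a j + t)) = (\<Sum>l\<le>d. t ^ l / fact l * (pderiv_at j ^^ l) f a)"
proof -
  define D where "D l u = (pderiv_at j ^^ l) f (a(j := a j + u))" for l u
  have poly: "poly_fun ((pderiv_at j ^^ l) f)" for l
    using hom_poly_pderiv_at_iter[OF assms] hom_poly_imp_poly_fun by blast
  have "(D l has_real_derivative D (Suc l) u) (at u)" for l u
    using DERIV_shift[of "\<lambda>t. (pderiv_at j ^^ l) f (a(j := t))" _ u "a j"]
      poly_fun_DERIV[OF poly, of l a j "a j + u"]
    unfolding D_def by (simp add: add.commute)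
  then have "\<exists>\<xi>. \<bar>\<xi>\<bar> \<le> \<bar>t\<bar> \<and> D 0 t = (\<Sum>l<Suc d. D l 0 / fact l * t ^ l) + D (Suc d) \<xi> / fact (Suc d) * t ^ Suc d"
    by (intro Maclaurin_all_le) auto
  moreover have "D (Suc d) u = 0" for u
    unfolding D_def by (subst hom_poly_pderiv_at_iter_eq_0[OF assms]) auto
  ultimately have "D 0 t = (\<Sum>l<Suc d. D l 0 / fact l * t ^ l)" by auto
  then show ?thesis unfolding D_def lessThan_Suc_atMost by (simp add: mult_ac)
qed

subsection \<open>Elementary and complete homogeneous differential operators\<close>

text \<open>The coefficient of \<open>t^q\<close> in the product of the factors
  \<open>1 + t \<partial>_j\<close> over \<open>js\<close>, that is, the elementary symmetric
  function of the derivations. Repeated entries of the list stand for repeated factors.\<close>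

fun elem_op :: "nat list \<Rightarrow> nat \<Rightarrow> ((nat \<Rightarrow> real) \<Rightarrow> real) \<Rightarrow> (nat \<Rightarrow> real) \<Rightarrow> real" where
  "elem_op [] q f = (if q = 0 then f else (\<lambda>a. 0))"
| "elem_op (j # js) 0 f = elem_op js 0 f"
| "elem_op (j # js) (Suc q) f = (\<lambda>a. elem_op js (Suc q) f a + pderiv_at j (elem_op js q f) a)"

text \<open>The coefficient of \<open>t^q\<close> in the product of the series
  \<open>1 / (1 - t \<partial>_j)\<close> over \<open>js\<close>, the complete homogeneous symmetric
  function. The recursion reads off \<open>G = G' + t \<partial>_j G\<close> from
  \<open>(1 - t \<partial>_j) G = G'\<close>, hence \<open>j\<close> stays in the list when
  \<open>q\<close> decreases.\<close>

fun compl_op :: "nat list \<Rightarrow> nat \<Rightarrow> ((nat \<Rightarrow> real) \<Rightarrow> real) \<Rightarrow> (nat \<Rightarrow> real) \<Rightarrow> real" where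
  "compl_op [] q f = (if q = 0 then f else (\<lambda>a. 0))"
| "compl_op (j # js) 0 f = compl_op js 0 f"
| "compl_op (j # js) (Suc q) f =
     (\<lambda>a. compl_op js (Suc q) f a + pderiv_at j (compl_op (j # js) q f) a)"

lemma elem_op_0 [simp]: "elem_op js 0 f = f"
  by (induction js) auto

lemma compl_op_0 [simp]: "compl_op js 0 f = f"
  by (induction js) auto

lemma poly_fun_elem_op: "poly_fun f \<Longrightarrow> poly_fun (elem_op js q f)"
  by (induction js q f rule: elem_op.induct)
    (auto intro: poly_fun.intros poly_fun_pderiv_at)

lemma poly_fun_compl_op: "poly_fun f \<Longrightarrow> poly_fun (compl_op js q f)"
  by (induction js q f rule: compl_op.induct)
    (auto intro: poly_fun.intros poly_fun_pderiv_at)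

lemma hom_poly_compl_op: "hom_poly V d f \<Longrightarrow> hom_poly V (d - q) (compl_op js q f)"
proof (induction js q f rule: compl_op.induct)
  case (3 j js q f)
  then have "hom_poly V (d - Suc q) (pderiv_at j (compl_op (j # js) q f))"
    using hom_poly_pderiv_at[of V "d - q"] by simp
  with 3 show ?case by (simp add: hom_poly.add)
qed (auto intro: hom_poly.zero)

lemma elem_op_add:
  "poly_fun f \<Longrightarrow> poly_fun g \<Longrightarrow>
    elem_op js q (\<lambda>a. f a + g a) = (\<lambda>a. elem_op js q f a + elem_op js q g a)"
proof (induction js arbitrary: q)
  case (Cons j js)
  then show ?case by (cases q) (auto simp: pderiv_at_add poly_fun_elem_op)
qed auto

lemma elem_op_pderiv_at:
  "poly_fun f \<Longrightarrow> elem_op js q (pderiv_at i f) = pderiv_at i (elem_op js q f)"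
proof (induction js arbitrary: q)
  case Nil
  then show ?case by (simp add: pderiv_at_const)
next
  case (Cons j js)
  then show ?case
    by (cases q) (auto simp: pderiv_at_add poly_fun_elem_op poly_fun_pderiv_at
        pderiv_at_commute[of _ i j])
qed

text \<open>The coefficientwise form of \<open>\<Prod>\<^sub>j (1 - t \<partial>\<^sub>j) \<cdot> \<Prod>\<^sub>j (1 - t \<partial>\<^sub>j)\<^sup>-\<^sup>1 = 1\<close>.\<close>

lemma elem_compl_op:
  assumes "poly_fun f"
  shows "(\<Sum>q\<le>k. (-1) ^ q * elem_op js q (compl_op js (k - q) f) a) = (if k = 0 then f a else 0)"
proof (induction js)
  case Nil
  have "(\<Sum>q\<le>k. (-1) ^ q * elem_op [] q (compl_op [] (k - q) f) a) =
      (\<Sum>q\<le>k. if q = 0 then (if k = 0 then f a else 0) else 0)"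
    by (intro sum.cong) auto
  then show ?case by simp
next
  case (Cons j js)
  \<comment> \<open>The two factors contributed by \<open>j\<close>, namely
    \<open>1 - t \<partial>_j\<close> and its inverse, cancel, which leaves the sum for
    \<open>js\<close>.\<close>
  have "(\<Sum>q\<le>k. (-1) ^ q * elem_op (j # js) q (compl_op (j # js) (k - q) f) a) =
      (\<Sum>q\<le>k. (-1) ^ q * elem_op js q (compl_op js (k - q) f) a)"
  proof (cases k)
    case 0
    then show ?thesis by simp
  next
    case (Suc l)
    define H where "H = compl_op (j # js)"
    have H: "poly_fun (H q f)" for q unfolding H_def by (rule poly_fun_compl_op[OF assms])
    have "(\<Sum>q\<le>k. (-1) ^ q * elem_op (j # js) q (H (k - q) f) a) =
       (\<Sum>q\<le>k. (-1) ^ q * elem_op js q (H (k - q) f) a) -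
       (\<Sum>q\<le>l. (-1) ^ q * pderiv_at j (elem_op js q (H (l - q) f)) a)"
      unfolding Suc sum.atMost_Suc_shift by (simp add: sum.distrib sum_negf sum_subtractf algebra_simps)
    \<comment> \<open>The term \<open>q = k\<close> is split off because there the second index is 0
      and the recursion step of \<open>compl_op\<close> does not apply.\<close>
    also have "(\<Sum>q\<le>k. (-1) ^ q * elem_op js q (H (k - q) f) a) =
        (-1) ^ k * elem_op js k f a + (\<Sum>q\<le>l. (-1) ^ q * elem_op js q (H (k - q) f) a)"
      unfolding Suc by (simp add: H_def)
    also have "(\<Sum>q\<le>l. (-1) ^ q * elem_op js q (H (k - q) f) a) =
      (\<Sum>q\<le>l. (-1) ^ q * elem_op js q (compl_op js (k - q) f) a) +
       (\<Sum>q\<le>l. (-1) ^ q * pderiv_at j (elem_op js q (H (l - q) f)) a)"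
      unfolding sum.distrib[symmetric]
    proof (intro sum.cong refl)
      fix q assume "q \<in> {..l}"
      then have "k - q = Suc (l - q)" using Suc by auto
      then have "H (k - q) f = (\<lambda>a. compl_op js (k - q) f a + pderiv_at j (H (l - q) f) a)"
        unfolding H_def by simp
      then show "(-1) ^ q * elem_op js q (H (k - q) f) a =
        (-1) ^ q * elem_op js q (compl_op js (k - q) f) a +
        (-1) ^ q * pderiv_at j (elem_op js q (H (l - q) f)) a"
        by (simp add: elem_op_add elem_op_pderiv_at H assms poly_fun_compl_op poly_fun_pderiv_at
            distrib_left)
    qed
    finally show ?thesis unfolding H_def by (simp add: Suc)
  qed
  then show ?case using Cons.IH by simp
qed

text \<open>This is the binomial expansion of \<open>(1 + t \<partial>_i)^n\<close>, with Pascal's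
  rule as the induction step on \<open>n\<close>; it is the source of the binomial coefficients in
  \<open>D_op\<close>.\<close>

lemma elem_op_replicate_append:
  assumes "poly_fun f"
  shows "elem_op (replicate n i @ js) q f a =
    (\<Sum>p\<le>q. real (n choose p) * (pderiv_at i ^^ p) (elem_op js (q - p) f) a)"
proof (induction n arbitrary: q a)
  case 0
  have "(\<Sum>p\<le>q. real (0 choose p) * (pderiv_at i ^^ p) (elem_op js (q - p) f) a) =
     (\<Sum>p\<le>q. if p = 0 then elem_op js q f a else 0)"
    by (intro sum.cong) (auto simp: binomial_eq_0)
  then show ?case by simp
next
  case (Suc n)
  have iter: "poly_fun ((pderiv_at i ^^ p) (elem_op js q f))" for p q
    by (induction p) (auto intro: poly_fun_elem_op poly_fun_pderiv_at assms)
  show ?case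
  proof (cases q)
    case 0
    then show ?thesis by simp
  next
    case (Suc l)
    have "elem_op (replicate n i @ js) l f =
        (\<lambda>a. \<Sum>p\<le>l. real (n choose p) * (pderiv_at i ^^ p) (elem_op js (l - p) f) a)"
      using Suc.IH by blast
    then have "pderiv_at i (elem_op (replicate n i @ js) l f) a =
        (\<Sum>p\<le>l. real (n choose p) * (pderiv_at i ^^ Suc p) (elem_op js (l - p) f) a)"
      by (simp add: pderiv_at_sum poly_fun_scale pderiv_at_scale iter)
    then show ?thesis
      unfolding Suc using Suc.IH[of "Suc l" a]
      by (simp add: sum.atMost_Suc_shift sum.distrib algebra_simps del: funpow.simps sum.atMost_Suc)
  qed
qed

text \<open>A variant of \<open>D_index\<close> made for recursion: the lower bound \<open>s\<close>
  is free, and the empty list is allowed, which contributes exactly one element, for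
  \<open>q = 0\<close>.\<close>

definition diff_index :: "nat \<Rightarrow> nat \<Rightarrow> nat \<Rightarrow> (nat list \<times> nat list) set" where
  "diff_index s r q =
     {(is, ps). sorted_wrt (<) is \<and> set is \<subseteq> {s..r} \<and>
                length ps = length is \<and> (\<forall>p\<in>set ps. 1 \<le> p) \<and> sum_list ps = q}"

lemma diff_index_beyond: "r < s \<Longrightarrow> diff_index s r q = (if q = 0 then {([], [])} else {})"
  by (auto simp: diff_index_def)

lemma diff_index_rec:
  assumes "s \<le> r"
  shows "diff_index s r q = diff_index (Suc s) r q \<union>
    (\<lambda>(p, is, ps). (s # is, p # ps)) ` (SIGMA p:{1..q}. diff_index (Suc s) r (q - p))"
    (is "_ = ?A \<union> ?B")
proof (intro equalityI subsetI)
  fix x assume x: "x \<in> diff_index s r q"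
  obtain js ps where x_eq: "x = (js, ps)" by (cases x)
  show "x \<in> ?A \<union> ?B"
  proof (cases js)
    case Nil
    then show ?thesis using x x_eq by (auto simp: diff_index_def)
  next
    case (Cons j js')
    then obtain p ps' where ps: "ps = p # ps'" using x x_eq by (cases ps) (auto simp: diff_index_def)
    show ?thesis
    proof (cases "j = s")
      case True
      then have "(js', ps') \<in> diff_index (Suc s) r (q - p)" "p \<in> {1..q}"
        using x x_eq Cons ps by (auto simp: diff_index_def Suc_le_eq)
      then have "x \<in> ?B" unfolding x_eq Cons ps True by (intro image_eqI[of _ _ "(p, js', ps')"]) auto
      then show ?thesis by simp
    next
      case False
      then have "s < j" "\<forall>k\<in>set js'. j < k" using x x_eq Cons by (auto simp: diff_index_def)
      then have "x \<in> ?A"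
        using x x_eq Cons by (fastforce simp: diff_index_def Suc_le_eq)
      then show ?thesis by simp
    qed
  qed
next
  fix x assume "x \<in> ?A \<union> ?B"
  then show "x \<in> diff_index s r q"
  proof
    assume "x \<in> ?A"
    then show ?thesis by (auto simp: diff_index_def subset_iff Suc_le_eq)
  next
    assume "x \<in> ?B"
    then show ?thesis using assms
      by (fastforce simp: diff_index_def subset_iff Suc_le_eq)
  qed
qed

lemma finite_diff_index: "finite (diff_index s r q)"
proof (cases "s \<le> r")
  case True
  have "s \<le> Suc r" using True by simp
  then show ?thesis
  proof (induction arbitrary: q rule: inc_induct)
    case base
    then show ?case by (simp add: diff_index_beyond)
  next
    case (step k)
    then show ?case by (subst diff_index_rec) auto
  qed
qed (simp add: diff_index_beyond)

text \<open>Downward induction on \<open>s\<close>. In the binomial expansion for the block of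
  copies of \<open>s\<close>, the term \<open>p = 0\<close> accounts for the index lists that avoid
  \<open>s\<close>, and the terms with \<open>p\<close> at least 1 for those that start with
  \<open>s\<close> and exponent \<open>p\<close>.\<close>

lemma diff_index_sum_eq_elem_op:
  assumes "poly_fun f"
  shows "(\<Sum>(is, ps)\<in>diff_index s r q. real (\<Prod>(i, p)\<leftarrow>zip is ps. \<mu> i choose p) *
            foldr (\<lambda>(i, p). pderiv_at i ^^ p) (zip is ps) f a) =
         elem_op (concat (map (\<lambda>i. replicate (\<mu> i) i) [s..<Suc r])) q f a"
proof (cases "s \<le> Suc r")
  case True
  then show ?thesis
  proof (induction arbitrary: q a rule: inc_induct)
    case base
    then show ?case by (simp add: diff_index_beyond)
  next
    case (step s)
    define T where "T x a = (case x of (is, ps) \<Rightarrow> real (\<Prod>(i, p)\<leftarrow>zip is ps. \<mu> i choose p) *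
            foldr (\<lambda>(i, p). pderiv_at i ^^ p) (zip is ps) f a)" for x a
    define E where "E = elem_op (concat (map (\<lambda>i. replicate (\<mu> i) i) [Suc s..<Suc r]))"
    have iter: "poly_fun g \<Longrightarrow> poly_fun ((pderiv_at i ^^ p) g)" for i p g
      by (induction p) (auto intro: poly_fun_pderiv_at)
    have fold: "poly_fun (foldr (\<lambda>(i, p). pderiv_at i ^^ p) xs f)" for xs
      by (induction xs) (auto intro: assms iter)
    have polyT: "poly_fun (T x)" for x
      unfolding T_def by (cases x) (auto intro: poly_fun_scale fold)
    have IH: "E q f = (\<lambda>a. \<Sum>x\<in>diff_index (Suc s) r q. T x a)" for q
      using step.IH unfolding E_def T_def by (auto simp: fun_eq_iff)
    have iter_sum: "(pderiv_at i ^^ p) (\<lambda>a. \<Sum>x\<in>X. T x a) = (\<lambda>a. \<Sum>x\<in>X. (pderiv_at i ^^ p) (T x) a)"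
      for i p X by (induction p) (auto simp: pderiv_at_sum iter polyT)
    have iter_scale: "(pderiv_at i ^^ p) (\<lambda>a. c * g a) = (\<lambda>a. c * (pderiv_at i ^^ p) g a)"
      if "poly_fun g" for i p c g
      using that by (induction p) (auto simp: pderiv_at_scale iter)
    have T_Cons: "T (s # js, p # ps) a = real (\<mu> s choose p) * (pderiv_at s ^^ p) (T (js, ps)) a"
      for js p ps a
      unfolding T_def by (simp add: iter_scale fold)
    have sr: "s \<le> r" using step by simp
    have "(\<Sum>x\<in>diff_index s r q. T x a) = (\<Sum>x\<in>diff_index (Suc s) r q. T x a) +
      (\<Sum>x\<in>(\<lambda>(p, is, ps). (s # is, p # ps)) ` (SIGMA p:{1..q}. diff_index (Suc s) r (q - p)). T x a)"
      unfolding diff_index_rec[OF sr, of q]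
      by (intro sum.union_disjoint)
        (auto intro!: finite_imageI finite_SigmaI simp: finite_diff_index, auto simp: diff_index_def)
    also have "(\<Sum>x\<in>(\<lambda>(p, is, ps). (s # is, p # ps)) ` (SIGMA p:{1..q}. diff_index (Suc s) r (q - p)). T x a) =
      (\<Sum>(p, x)\<in>(SIGMA p:{1..q}. diff_index (Suc s) r (q - p)). real (\<mu> s choose p) * (pderiv_at s ^^ p) (T x) a)"
      by (subst sum.reindex) (auto simp: inj_on_def T_Cons intro!: sum.cong)
    also have "\<dots> = (\<Sum>p\<in>{1..q}. \<Sum>x\<in>diff_index (Suc s) r (q - p). real (\<mu> s choose p) * (pderiv_at s ^^ p) (T x) a)"
      by (subst sum.Sigma) (auto simp: finite_diff_index)
    also have "\<dots> = (\<Sum>p\<in>{1..q}. real (\<mu> s choose p) * (pderiv_at s ^^ p) (E (q - p) f) a)"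
      unfolding IH iter_sum by (simp add: sum_distrib_left)
    also have "(\<Sum>x\<in>diff_index (Suc s) r q. T x a) = E q f a" by (simp add: IH)
    also have "E q f a + (\<Sum>p\<in>{1..q}. real (\<mu> s choose p) * (pderiv_at s ^^ p) (E (q - p) f) a) =
       (\<Sum>p\<le>q. real (\<mu> s choose p) * (pderiv_at s ^^ p) (E (q - p) f) a)"
      unfolding atMost_atLeast0 by (subst sum.atLeast_Suc_atMost[of 0]) auto
    also have "\<dots> = elem_op (replicate (\<mu> s) s @ concat (map (\<lambda>i. replicate (\<mu> i) i) [Suc s..<Suc r])) q f a"
      unfolding E_def by (rule elem_op_replicate_append[OF assms, symmetric])
    finally show ?case
      unfolding T_def using sr by (simp add: upt_conv_Cons del: upt_Suc)
  qed
next
  case False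
  then show ?thesis by (simp add: diff_index_beyond)
qed

text \<open>One entry per edge from vertex 1 to an inner vertex. Edges into the sink
  \<open>r + 1\<close> are left out, since their insertion causes no differentiation.\<close>

abbreviation inner_targets :: "nat \<Rightarrow> (nat \<Rightarrow> nat \<Rightarrow> nat) \<Rightarrow> nat list" where
  "inner_targets r m \<equiv> concat (map (\<lambda>i. replicate (m 1 i) i) [2..<Suc r])"

lemma D_op_eq_elem_op:
  assumes "poly_fun f" "1 \<le> q"
  shows "D_op r m q f = elem_op (inner_targets r m) q f"
proof -
  have "D_index r q = diff_index 2 r q"
    using assms(2) by (auto simp: D_index_def diff_index_def)
  then show ?thesis
    using diff_index_sum_eq_elem_op[OF assms(1), where s = 2 and r = r and q = q and \<mu> = "m 1"]
    unfolding D_op_def by auto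
qed

text \<open>Solving the relation \<open>elem_compl_op\<close> for its term \<open>q = 0\<close>
  gives exactly the recursion that defines \<open>P_op\<close>, so strong induction on
  \<open>k\<close> identifies the two.\<close>

lemma P_op_eq_compl_op:
  assumes "poly_fun f"
  shows "P_op r m k f = compl_op (inner_targets r m) k f"
proof (induction k rule: less_induct)
  case (less k)
  show ?case
  proof (cases k)
    case 0
    then show ?thesis by simp
  next
    case (Suc l)
    let ?E = "elem_op (inner_targets r m)" and ?H = "compl_op (inner_targets r m)"
    have "P_op r m k f a = ?H k f a" for a
    proof -
      have "P_op r m k f a = (\<Sum>q = 1..k. (-1) ^ (q + 1) * ?E q (?H (k - q) f) a)"
        unfolding Suc P_op.simps
        by (intro sum.cong refl)
          (use less.IH Suc in \<open>simp add: D_op_eq_elem_op poly_fun_compl_op assms\<close>)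
      also have "\<dots> = - (\<Sum>q = 1..k. (-1) ^ q * ?E q (?H (k - q) f) a)"
        by (simp add: sum_negf)
      also have "(\<Sum>q = 1..k. (-1) ^ q * ?E q (?H (k - q) f) a) =
         (\<Sum>q\<le>k. (-1) ^ q * ?E q (?H (k - q) f) a) - ?H k f a"
        unfolding atMost_atLeast0 by (subst sum.atLeast_Suc_atMost[of 0]) auto
      finally show ?thesis using elem_compl_op[OF assms, where k = k] Suc by simp
    qed
    then show ?thesis by auto
  qed
qed

subsection \<open>Integrals along an edge\<close>

text \<open>Restricted to a line with direction \<open>w\<close>, a homogeneous polynomial of degree
  \<open>d\<close> is a polynomial in \<open>t\<close> whose coefficient of \<open>t^l\<close> is
  homogeneous of degree \<open>d - l\<close> in the base point.\<close>

lemma hom_poly_line_expansion: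
  assumes "hom_poly V d p"
  shows "\<exists>c. (\<forall>l\<le>d. hom_poly V (d - l) (c l)) \<and>
             (\<forall>a t. p (\<lambda>i. a i + t * w i) = (\<Sum>l\<le>d. t ^ l * c l a))"
  using assms
proof (induction rule: hom_poly.induct)
  case (zero d)
  then show ?case by (intro exI[of _ "\<lambda>_ _. 0"]) (simp add: hom_poly.zero)
next
  case (const c)
  then show ?case by (intro exI[of _ "\<lambda>_ _. c"]) (simp add: hom_poly.const)
next
  case (mult i d f)
  then obtain c where c: "\<And>l. l \<le> d \<Longrightarrow> hom_poly V (d - l) (c l)"
      "\<And>a t. f (\<lambda>i. a i + t * w i) = (\<Sum>l\<le>d. t ^ l * c l a)" by blast
  \<comment> \<open>Multiplication by the coordinate \<open>a i + t * w i\<close>: the first part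
    keeps the power of \<open>t\<close>, the second raises it by one.\<close>
  define c' where "c' l a = (if l \<le> d then a i * c l a else 0) +
    (case l of 0 \<Rightarrow> 0 | Suc l' \<Rightarrow> w i * c l' a)" for l a
  have "hom_poly V (Suc d - l) (c' l)" if "l \<le> Suc d" for l
  proof -
    have "hom_poly V (Suc d - l) (\<lambda>a. if l \<le> d then a i * c l a else 0)"
      using hom_poly.mult[OF mult.hyps(1) c(1), of l] that
      by (cases "l \<le> d") (auto simp: Suc_diff_le intro: hom_poly.zero)
    moreover have "hom_poly V (Suc d - l) (\<lambda>a. case l of 0 \<Rightarrow> 0 | Suc l' \<Rightarrow> w i * c l' a)"
      using c(1) that by (cases l) (auto intro: hom_poly.zero hom_poly_scale)
    ultimately show ?thesis unfolding c'_def by (rule hom_poly.add)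
  qed
  moreover have "(a i + t * w i) * f (\<lambda>i. a i + t * w i) = (\<Sum>l\<le>Suc d. t ^ l * c' l a)" for a t
  proof -
    have "(\<Sum>l\<le>Suc d. t ^ l * (if l \<le> d then a i * c l a else 0)) = a i * (\<Sum>l\<le>d. t ^ l * c l a)"
      by (simp add: sum_distrib_left mult_ac)
    moreover have "(\<Sum>l\<le>Suc d. t ^ l * (case l of 0 \<Rightarrow> 0 | Suc l' \<Rightarrow> w i * c l' a)) =
        t * w i * (\<Sum>l\<le>d. t ^ l * c l a)"
      unfolding sum.atMost_Suc_shift by (simp add: sum_distrib_left mult_ac)
    ultimately show ?thesis unfolding c c'_def by (simp add: distrib_left distrib_right sum.distrib)
  qed
  ultimately show ?case by blast
next
  case (add d f g)
  from add.IH(1) obtain c1 where c1: "\<And>l. l \<le> d \<Longrightarrow> hom_poly V (d - l) (c1 l)"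
      "\<And>a t. f (\<lambda>i. a i + t * w i) = (\<Sum>l\<le>d. t ^ l * c1 l a)" by blast
  from add.IH(2) obtain c2 where c2: "\<And>l. l \<le> d \<Longrightarrow> hom_poly V (d - l) (c2 l)"
      "\<And>a t. g (\<lambda>i. a i + t * w i) = (\<Sum>l\<le>d. t ^ l * c2 l a)" by blast
  have "\<forall>l\<le>d. hom_poly V (d - l) (\<lambda>a. c1 l a + c2 l a)"
    using c1(1) c2(1) by (blast intro: hom_poly.add)
  moreover have "\<forall>a t. f (\<lambda>i. a i + t * w i) + g (\<lambda>i. a i + t * w i) =
      (\<Sum>l\<le>d. t ^ l * (c1 l a + c2 l a))"
    unfolding c1 c2 by (simp add: sum.distrib distrib_left)
  ultimately show ?case by (intro exI[of _ "\<lambda>l a. c1 l a + c2 l a"]) (rule conjI)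
qed

lemma has_integral_power:
  assumes "(0::real) \<le> x"
  shows "((\<lambda>t. t ^ l) has_integral x ^ Suc l / real (Suc l)) {0..x}"
proof -
  have "((\<lambda>t. t ^ l) has_integral x ^ Suc l / real (Suc l) - 0 ^ Suc l / real (Suc l)) {0..x}"
  proof (rule fundamental_theorem_of_calculus[OF assms])
    fix t :: real
    have "((\<lambda>t. t ^ Suc l / real (Suc l)) has_real_derivative t ^ l) (at t within {0..x})"
      by (rule derivative_eq_intros refl | simp)+
    then show "((\<lambda>t. t ^ Suc l / real (Suc l)) has_vector_derivative t ^ l) (at t within {0..x})"
      by (simp add: has_real_derivative_iff_has_vector_derivative)
  qed
  then show ?thesis by simp
qed

text \<open>The line expansion is integrated termwise: \<open>t^l\<close> contributes
  \<open>a v ^ Suc l / Suc l\<close>, which makes up for the degree \<open>d - l\<close> of its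
  coefficient and adds one.\<close>

lemma hom_poly_edge_integral:
  assumes "hom_poly V d p" "v \<in> V"
  shows "\<exists>q. hom_poly V (Suc d) q \<and>
    (\<forall>a. 0 \<le> a v \<longrightarrow> ((\<lambda>t. p (\<lambda>i. a i - t * root_vec v j i)) has_integral q a) {0..a v})"
proof -
  obtain c where c: "\<And>l. l \<le> d \<Longrightarrow> hom_poly V (d - l) (c l)"
    "\<And>a t. p (\<lambda>i. a i + t * - root_vec v j i) = (\<Sum>l\<le>d. t ^ l * c l a)"
    using hom_poly_line_expansion[OF assms(1), of "\<lambda>i. - root_vec v j i"] by blast
  define q where "q a = (\<Sum>l\<le>d. 1 / real (Suc l) * (a v ^ Suc l * c l a))" for a
  have "hom_poly V (Suc d) q"
    unfolding q_def
  proof (intro hom_poly_sum hom_poly_scale)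
    fix l assume "l \<in> {..d}"
    then show "hom_poly V (Suc d) (\<lambda>a. a v ^ Suc l * c l a)"
      using hom_poly_power_mult[OF assms(2) c(1), of l "Suc l"] by simp
  qed
  moreover have "((\<lambda>t. p (\<lambda>i. a i - t * root_vec v j i)) has_integral q a) {0..a v}" if "0 \<le> a v" for a
  proof -
    have "((\<lambda>t. \<Sum>l\<le>d. t ^ l * c l a) has_integral (\<Sum>l\<le>d. a v ^ Suc l / real (Suc l) * c l a)) {0..a v}"
      by (intro has_integral_sum has_integral_mult_left has_integral_power that) auto
    then show ?thesis using c(2)[of a] by (simp add: q_def mult_ac)
  qed
  ultimately show ?thesis by blast
qed

lemma hom_poly_tendsto:
  "hom_poly V d p \<Longrightarrow> (\<And>i. i \<in> V \<Longrightarrow> (\<lambda>k. b k i) \<longlonglongrightarrow> a i) \<Longrightarrow> (\<lambda>k. p (b k)) \<longlonglongrightarrow> p a"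
  by (induction rule: hom_poly.induct) (auto intro: tendsto_intros)

subsection \<open>Densities of the netflow map\<close>

abbreviation lborel_PiM :: "'i set \<Rightarrow> ('i \<Rightarrow> real) measure" where
  "lborel_PiM A \<equiv> \<Pi>\<^sub>M i\<in>A. lborel"

lemma product_sigma_finite_lborel: "product_sigma_finite (\<lambda>i. lborel :: real measure)"
  by standard

lemma sigma_finite_lborel_PiM: "finite A \<Longrightarrow> sigma_finite_measure (lborel_PiM A)"
  by (rule product_sigma_finite.sigma_finite[OF product_sigma_finite_lborel])

text \<open>A product measure is determined by its values on boxes, where the claim reduces to
  translation invariance in each coordinate.\<close>

lemma distr_lborel_PiM_shift:
  assumes "finite A"
  shows "distr (lborel_PiM A) (lborel_PiM A) (\<lambda>x. \<lambda>i\<in>A. x i + c i) = lborel_PiM A"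
proof -
  interpret product_sigma_finite "\<lambda>i. lborel :: real measure"
    by (rule product_sigma_finite_lborel)
  show ?thesis
  proof (rule PiM_eqI[OF assms])
    fix B :: "'a \<Rightarrow> real set" assume B: "\<And>i. i \<in> A \<Longrightarrow> B i \<in> sets lborel"
    have B': "(\<lambda>x. x + c i) -` B i \<in> sets lborel" if "i \<in> A" for i
      using measurable_sets[of "\<lambda>x. x + c i" lborel lborel "B i"] B[OF that] by simp
    have "emeasure (distr (lborel_PiM A) (lborel_PiM A) (\<lambda>x. \<lambda>i\<in>A. x i + c i)) (Pi\<^sub>E A B) =
      emeasure (lborel_PiM A) ((\<lambda>x. \<lambda>i\<in>A. x i + c i) -` Pi\<^sub>E A B \<inter> space (lborel_PiM A))"
      by (intro emeasure_distr sets_PiM_I_finite assms B) auto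
    also have "(\<lambda>x. \<lambda>i\<in>A. x i + c i) -` Pi\<^sub>E A B \<inter> space (lborel_PiM A) = (\<Pi>\<^sub>E i\<in>A. (\<lambda>x. x + c i) -` B i)"
      by (auto simp: space_PiM PiE_iff)
    also have "emeasure (lborel_PiM A) \<dots> = (\<Prod>i\<in>A. emeasure lborel ((\<lambda>x. x + c i) -` B i))"
      by (intro emeasure_PiM assms B')
    also have "\<dots> = (\<Prod>i\<in>A. emeasure lborel (B i))"
    proof (intro prod.cong refl)
      fix i assume i: "i \<in> A"
      have "emeasure lborel (B i) = emeasure (distr lborel borel ((+) (c i))) (B i)"
        by (simp add: lborel_distr_plus)
      also have "(+) (c i) = (\<lambda>x. x + c i)" by (auto simp: add.commute)
      also have "emeasure (distr lborel borel \<dots>) (B i) = emeasure lborel ((\<lambda>x. x + c i) -` B i)"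
        using B[OF i] by (subst emeasure_distr) auto
      finally show "emeasure lborel ((\<lambda>x. x + c i) -` B i) = emeasure lborel (B i)" by simp
    qed
    finally show "emeasure (distr (lborel_PiM A) (lborel_PiM A) (\<lambda>x. \<lambda>i\<in>A. x i + c i)) (Pi\<^sub>E A B) =
      (\<Prod>i\<in>A. emeasure lborel (B i))" .
  qed simp
qed

lemma nn_integral_lborel_PiM_shift:
  assumes "finite A" and [measurable]: "f \<in> borel_measurable (lborel_PiM A)"
  shows "(\<integral>\<^sup>+x. f (\<lambda>i\<in>A. x i + c i) \<partial>lborel_PiM A) = (\<integral>\<^sup>+x. f x \<partial>lborel_PiM A)"
proof -
  have "(\<integral>\<^sup>+x. f x \<partial>lborel_PiM A) =
      (\<integral>\<^sup>+x. f x \<partial>distr (lborel_PiM A) (lborel_PiM A) (\<lambda>x. \<lambda>i\<in>A. x i + c i))"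
    by (simp only: distr_lborel_PiM_shift[OF assms(1)])
  also have "\<dots> = (\<integral>\<^sup>+x. f (\<lambda>i\<in>A. x i + c i) \<partial>lborel_PiM A)"
    by (intro nn_integral_distr) auto
  finally show ?thesis by simp
qed

lemma distr_lborel_PiM_reindex:
  assumes "finite B" "inj_on h B"
  shows "distr (lborel_PiM (h ` B)) (lborel_PiM B) (\<lambda>x. \<lambda>b\<in>B. x (h b)) = lborel_PiM B"
proof -
  have [measurable]: "(\<lambda>x. \<lambda>b\<in>B. x (h b)) \<in> measurable (lborel_PiM (h ` B)) (lborel_PiM B)"
    by (intro measurable_restrict measurable_component_singleton) auto
  show ?thesis
  proof (rule product_sigma_finite.PiM_eqI[OF product_sigma_finite_lborel assms(1)])
    fix E :: "'a \<Rightarrow> real set" assume E: "\<And>i. i \<in> B \<Longrightarrow> E i \<in> sets lborel"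
    define E' where "E' i = E (inv_into B h i)" for i
    have E': "E' (h b) = E b" if "b \<in> B" for b
      using that assms(2) by (simp add: E'_def)
    have "emeasure (distr (lborel_PiM (h ` B)) (lborel_PiM B) (\<lambda>x. \<lambda>b\<in>B. x (h b))) (Pi\<^sub>E B E) =
      emeasure (lborel_PiM (h ` B)) ((\<lambda>x. \<lambda>b\<in>B. x (h b)) -` Pi\<^sub>E B E \<inter> space (lborel_PiM (h ` B)))"
      by (intro emeasure_distr sets_PiM_I_finite assms E) auto
    also have "(\<lambda>x. \<lambda>b\<in>B. x (h b)) -` Pi\<^sub>E B E \<inter> space (lborel_PiM (h ` B)) = Pi\<^sub>E (h ` B) E'"
      by (auto simp: space_PiM PiE_iff E')
    also have "emeasure (lborel_PiM (h ` B)) \<dots> = (\<Prod>i\<in>h ` B. emeasure lborel (E' i))"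
      using assms(1) E E' by (intro product_sigma_finite.emeasure_PiM[OF product_sigma_finite_lborel]) auto
    also have "\<dots> = (\<Prod>i\<in>B. emeasure lborel (E i))"
      using assms(2) by (simp add: prod.reindex E')
    finally show "emeasure (distr (lborel_PiM (h ` B)) (lborel_PiM B) (\<lambda>x. \<lambda>b\<in>B. x (h b))) (Pi\<^sub>E B E) =
      (\<Prod>i\<in>B. emeasure lborel (E i))" .
  qed simp
qed

lemma nn_integral_lborel_PiM_reindex:
  assumes "finite B" "inj_on h B" and [measurable]: "f \<in> borel_measurable (lborel_PiM B)"
  shows "(\<integral>\<^sup>+x. f (\<lambda>b\<in>B. x (h b)) \<partial>lborel_PiM (h ` B)) = (\<integral>\<^sup>+x. f x \<partial>lborel_PiM B)"
proof -
  have [measurable]: "(\<lambda>x. \<lambda>b\<in>B. x (h b)) \<in> measurable (lborel_PiM (h ` B)) (lborel_PiM B)"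
    by (intro measurable_restrict measurable_component_singleton) auto
  have "(\<integral>\<^sup>+x. f x \<partial>lborel_PiM B) =
      (\<integral>\<^sup>+x. f x \<partial>distr (lborel_PiM (h ` B)) (lborel_PiM B) (\<lambda>x. \<lambda>b\<in>B. x (h b)))"
    by (simp only: distr_lborel_PiM_reindex[OF assms(1,2)])
  also have "\<dots> = (\<integral>\<^sup>+x. f (\<lambda>b\<in>B. x (h b)) \<partial>lborel_PiM (h ` B))"
    by (intro nn_integral_distr) auto
  finally show ?thesis by simp
qed

section \<open>Netflow in coordinates, and the effect of one more edge on the density\<close>

definition edge_vec :: "nat \<times> nat \<times> nat \<Rightarrow> nat \<Rightarrow> real" where
  "edge_vec e = root_vec (fst e) (fst (snd e))"

definition orthant :: "'i set \<Rightarrow> ('i \<Rightarrow> real) set" where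
  "orthant I = {y. \<forall>t\<in>I. 0 \<le> y t}"

text \<open>The coordinate at the sink \<open>n\<close> is dropped, as it is minus the sum of the
  others. What remains are the coordinates in the basis \<open>e_l - e_n\<close>, in which
  \<open>root_space_measure\<close> is Lebesgue measure.\<close>

definition net :: "nat \<Rightarrow> nat \<Rightarrow> (nat \<times> nat \<times> nat) set \<Rightarrow> (nat \<times> nat \<times> nat \<Rightarrow> real) \<Rightarrow> nat \<Rightarrow> real" where
  "net s n I y = (\<lambda>l\<in>{s..<n}. \<Sum>e\<in>I. y e * edge_vec e l)"

text \<open>
  The image under \<open>net s n I\<close> of Lebesgue measure on the nonnegative orthant has a density which
  is given by \<open>p\<close> on the closed nice chamber and vanishes where some vertex \<open>l \<le> v\<close> has
  negative netflow (no edge of \<open>I\<close> enters such a vertex).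
\<close>

definition flow_density ::
    "nat \<Rightarrow> nat \<Rightarrow> nat \<Rightarrow> (nat \<times> nat \<times> nat) set \<Rightarrow> ((nat \<Rightarrow> real) \<Rightarrow> real) \<Rightarrow> bool" where
  "flow_density s n v I p \<longleftrightarrow> (\<exists>W\<in>borel_measurable (lborel_PiM {s..<n}).
     (\<forall>g\<in>borel_measurable (lborel_PiM {s..<n}).
        (\<integral>\<^sup>+y. indicator (orthant I) y * g (net s n I y) \<partial>lborel_PiM I) =
        (\<integral>\<^sup>+a. W a * g a \<partial>lborel_PiM {s..<n})) \<and>
     (\<forall>a\<in>space (lborel_PiM {s..<n}). (\<exists>l\<in>{s..<n}. l \<le> v \<and> a l < 0) \<longrightarrow> W a = 0) \<and>
     (\<forall>a\<in>space (lborel_PiM {s..<n}). (\<forall>l\<in>{s..<n}. 0 \<le> a l) \<longrightarrow> W a = ennreal (p a) \<and> 0 \<le> p a))"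

lemma flow_density_mono: "flow_density s n v I p \<Longrightarrow> v' \<le> v \<Longrightarrow> flow_density s n v' I p"
  unfolding flow_density_def
  by (erule bexE, rule bexI) (intro conjI ballI impI, auto dest: order_trans)

lemma measurable_coordinate:
  assumes "t \<in> I"
  shows "(\<lambda>y. y t) \<in> borel_measurable (lborel_PiM I)"
proof -
  have "(\<lambda>y. y t) \<in> measurable (lborel_PiM I) lborel"
    by (rule measurable_component_singleton[OF assms])
  then show ?thesis by simp
qed

lemma measurable_net [measurable]:
  "net s n I \<in> measurable (lborel_PiM I) (lborel_PiM {s..<n})"
  unfolding net_def
proof (rule measurable_restrict)
  fix l
  have e: "(\<lambda>y. y e * edge_vec e l) \<in> borel_measurable (lborel_PiM I)" if "e \<in> I" for e
    by (rule borel_measurable_times[OF measurable_coordinate[OF that] borel_measurable_const])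
  have "(\<lambda>y. \<Sum>e\<in>I. y e * edge_vec e l) \<in> borel_measurable (lborel_PiM I)"
    by (rule borel_measurable_sum) (rule e)
  then show "(\<lambda>y. \<Sum>e\<in>I. y e * edge_vec e l) \<in> measurable (lborel_PiM I) lborel"
    by simp
qed

lemma orthant_measurable:
  assumes "finite I"
  shows "orthant I \<inter> space (lborel_PiM I) \<in> sets (lborel_PiM I)"
proof -
  have "{y \<in> space (lborel_PiM I). \<forall>t\<in>I. 0 \<le> y t} \<in> sets (lborel_PiM I)"
  proof (rule sets.sets_Collect_finite_All[OF _ assms])
    fix t assume "t \<in> I"
    from measurable_coordinate[OF this]
    have [measurable]: "(\<lambda>y. y t) \<in> borel_measurable (lborel_PiM I)" .
    show "{y \<in> space (lborel_PiM I). 0 \<le> y t} \<in> sets (lborel_PiM I)" by measurable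
  qed
  also have "{y \<in> space (lborel_PiM I). \<forall>t\<in>I. 0 \<le> y t} = orthant I \<inter> space (lborel_PiM I)"
    by (auto simp: orthant_def)
  finally show ?thesis .
qed

lemma borel_measurable_indicator_orthant [measurable]:
  "finite I \<Longrightarrow> (indicator (orthant I) :: _ \<Rightarrow> ennreal) \<in> borel_measurable (lborel_PiM I)"
  by (simp add: borel_measurable_indicator_iff orthant_measurable)

text \<open>With a single edge from every vertex to the sink, the netflow at \<open>l\<close> is the
  flow on \<open>(l, n, 1)\<close>. So \<open>net\<close> merely relabels coordinates, and the
  density is the indicator of the orthant.\<close>

lemma flow_density_base: "flow_density s n v ((\<lambda>l. (l, n, Suc 0)) ` {s..<n}) (\<lambda>a. 1)"
proof -
  let ?h = "\<lambda>l. (l, n, Suc 0)" and ?L = "lborel_PiM {s..<n}"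
  have inj: "inj_on ?h {s..<n}" by (auto simp: inj_on_def)
  have net: "net s n (?h ` {s..<n}) y = (\<lambda>l\<in>{s..<n}. y (?h l))" for y
  proof -
    have "(\<Sum>l'\<in>{s..<n}. y (?h l') * edge_vec (?h l') l) = y (?h l)" if "l \<in> {s..<n}" for l
    proof -
      have "(\<Sum>l'\<in>{s..<n}. y (?h l') * edge_vec (?h l') l) = (\<Sum>l'\<in>{s..<n}. if l' = l then y (?h l') else 0)"
        using that by (intro sum.cong) (auto simp: edge_vec_def root_vec_def)
      then show ?thesis using that by simp
    qed
    then show ?thesis
      unfolding net_def sum.reindex[OF inj] by (auto simp: fun_eq_iff)
  qed
  have ind: "indicator (orthant (?h ` {s..<n})) y = (indicator (orthant {s..<n}) (\<lambda>l\<in>{s..<n}. y (?h l)) :: ennreal)"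
    for y by (auto simp: orthant_def indicator_def)
  show ?thesis
    unfolding flow_density_def
  proof (intro bexI[of _ "indicator (orthant {s..<n})"] conjI ballI)
    fix g :: "_ \<Rightarrow> ennreal" assume [measurable]: "g \<in> borel_measurable ?L"
    show "(\<integral>\<^sup>+y. indicator (orthant (?h ` {s..<n})) y * g (net s n (?h ` {s..<n}) y) \<partial>lborel_PiM (?h ` {s..<n})) =
       (\<integral>\<^sup>+a. indicator (orthant {s..<n}) a * g a \<partial>?L)"
      unfolding net ind
      by (rule nn_integral_lborel_PiM_reindex[where f = "\<lambda>a. indicator (orthant {s..<n}) a * g a", OF _ inj]) auto
  qed (auto simp: orthant_def indicator_def not_le[symmetric])
qed

text \<open>By Fubini, the new density at \<open>a\<close> integrates the old one over all points
  \<open>a - t (e_v - e_j)\<close> with \<open>t\<close> nonnegative. Beyond \<open>t = a v\<close>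
  the coordinate at \<open>v\<close> is negative and the old density vanishes; up to
  \<open>a v\<close> the point stays in the closed chamber, since the coordinate at \<open>j\<close>
  only grows, and the old density is \<open>p\<close>.\<close>

lemma flow_density_insert:
  assumes dens: "flow_density s n v I p" and fin: "finite I" and notin: "(v, j, k) \<notin> I"
    and v: "s \<le> v" "v < j" "j \<le> n"
    and p: "\<And>a b. (\<And>l. l \<in> {s..<n} \<Longrightarrow> a l = b l) \<Longrightarrow> p a = p b"
    and q: "\<And>a. (\<forall>l\<in>{s..<n}. 0 \<le> a l) \<Longrightarrow>
              ((\<lambda>t. p (\<lambda>l. a l - t * root_vec v j l)) has_integral q a) {0..a v}"
  shows "flow_density s n v (insert (v, j, k) I) q"
proof -
  let ?e = "(v, j, k)" and ?L = "lborel_PiM {s..<n}"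
  obtain W where W [measurable]: "W \<in> borel_measurable ?L"
    and W_int: "\<And>g. g \<in> borel_measurable ?L \<Longrightarrow>
        (\<integral>\<^sup>+y. indicator (orthant I) y * g (net s n I y) \<partial>lborel_PiM I) = (\<integral>\<^sup>+a. W a * g a \<partial>?L)"
    and W_0: "\<And>a l. a \<in> space ?L \<Longrightarrow> l \<in> {s..<n} \<Longrightarrow> l \<le> v \<Longrightarrow> a l < 0 \<Longrightarrow> W a = 0"
    and W_p: "\<And>a. a \<in> space ?L \<Longrightarrow> (\<forall>l\<in>{s..<n}. 0 \<le> a l) \<Longrightarrow> W a = ennreal (p a) \<and> 0 \<le> p a"
    using dens unfolding flow_density_def by blast
  \<comment> \<open>The restriction discards the coordinate at the sink, so for \<open>j = n\<close>
    only the coordinate at \<open>v\<close> moves.\<close>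
  define S where "S t a = (\<lambda>l\<in>{s..<n}. a l + t * root_vec v j l)" for t and a :: "nat \<Rightarrow> real"
  have S_meas [measurable]: "(\<lambda>(t, a). S t a) \<in> measurable (borel \<Otimes>\<^sub>M ?L) ?L"
    unfolding S_def split_beta by measurable
  have S_space: "S t a \<in> space ?L" for t a
    by (auto simp: S_def space_PiM)
  have S_inv: "S (- t) (S t a) = a" if "a \<in> space ?L" for t a
    using that by (auto simp: S_def space_PiM PiE_iff extensional_def fun_eq_iff)
  \<comment> \<open>Here \<open>t\<close> is the flow carried by the new edge.\<close>
  define W' where "W' a = (\<integral>\<^sup>+t. indicator {0..} t * W (S (- t) a) \<partial>lborel)" for a
  have W' [measurable]: "W' \<in> borel_measurable ?L"
    unfolding W'_def by measurable
  interpret psf: product_sigma_finite "\<lambda>i. lborel :: real measure"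
    by (rule product_sigma_finite_lborel)
  interpret L: sigma_finite_measure ?L by (rule sigma_finite_lborel_PiM) simp
  interpret P: pair_sigma_finite ?L "lborel :: real measure" ..
  have integral: "(\<integral>\<^sup>+y. indicator (orthant (insert ?e I)) y * g (net s n (insert ?e I) y) \<partial>lborel_PiM (insert ?e I)) =
      (\<integral>\<^sup>+a. W' a * g a \<partial>?L)" if [measurable]: "g \<in> borel_measurable ?L" for g
  proof -
    have ind: "indicator (orthant (insert ?e I)) (x(?e := t)) = (indicator {0..} t * indicator (orthant I) x :: ennreal)"
      for x t using notin by (auto simp: orthant_def indicator_def)
    have net: "net s n (insert ?e I) (x(?e := t)) = S t (net s n I x)" for x t
    proof -
      have "(\<Sum>e\<in>I. (x(?e := t)) e * edge_vec e l) = (\<Sum>e\<in>I. x e * edge_vec e l)" for l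
        using notin by (intro sum.cong) auto
      then show ?thesis
        unfolding net_def S_def using fin notin
        by (auto simp: fun_eq_iff edge_vec_def)
    qed
    have "(\<integral>\<^sup>+y. indicator (orthant (insert ?e I)) y * g (net s n (insert ?e I) y) \<partial>lborel_PiM (insert ?e I)) =
      (\<integral>\<^sup>+t. \<integral>\<^sup>+x. indicator (orthant (insert ?e I)) (x(?e := t)) * g (net s n (insert ?e I) (x(?e := t))) \<partial>lborel_PiM I \<partial>lborel)"
      using fin notin by (intro psf.product_nn_integral_insert_rev) auto
    also have "\<dots> = (\<integral>\<^sup>+t. indicator {0..} t * (\<integral>\<^sup>+x. indicator (orthant I) x * g (S t (net s n I x)) \<partial>lborel_PiM I) \<partial>lborel)"
      unfolding ind net mult.assoc
      using fin by (intro nn_integral_cong nn_integral_cmult) measurable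
    also have "\<dots> = (\<integral>\<^sup>+t. indicator {0..} t * (\<integral>\<^sup>+a. W a * g (S t a) \<partial>?L) \<partial>lborel)"
      by (subst W_int) auto
    \<comment> \<open>For fixed \<open>t\<close> this is the substitution that replaces
      \<open>S t a\<close> by \<open>a\<close>, a translation.\<close>
    also have "\<dots> = (\<integral>\<^sup>+t. indicator {0..} t * (\<integral>\<^sup>+a. W (S (- t) a) * g a \<partial>?L) \<partial>lborel)"
    proof -
      have "(\<integral>\<^sup>+a. W a * g (S t a) \<partial>?L) = (\<integral>\<^sup>+a. W (S (- t) a) * g a \<partial>?L)" for t
      proof -
        have "(\<integral>\<^sup>+a. W a * g (S t a) \<partial>?L) = (\<integral>\<^sup>+a. W (S (- t) (S t a)) * g (S t a) \<partial>?L)"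
          by (intro nn_integral_cong) (simp add: S_inv)
        also have "\<dots> = (\<integral>\<^sup>+a. W (S (- t) a) * g a \<partial>?L)"
          unfolding S_def[of t]
          by (rule nn_integral_lborel_PiM_shift[where f = "\<lambda>a. W (S (- t) a) * g a"]) auto
        finally show ?thesis .
      qed
      then show ?thesis by simp
    qed
    also have "\<dots> = (\<integral>\<^sup>+t. (\<integral>\<^sup>+a. indicator {0..} t * W (S (- t) a) * g a \<partial>?L) \<partial>lborel)"
      unfolding mult.assoc
      by (intro nn_integral_cong nn_integral_cmult[symmetric]) measurable
    also have "\<dots> = (\<integral>\<^sup>+a. (\<integral>\<^sup>+t. indicator {0..} t * W (S (- t) a) * g a \<partial>lborel) \<partial>?L)"
      by (rule P.Fubini') measurable
    also have "\<dots> = (\<integral>\<^sup>+a. W' a * g a \<partial>?L)"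
      unfolding W'_def by (intro nn_integral_cong nn_integral_multc) measurable
    finally show ?thesis .
  qed
  have vanish: "W' a = 0" if a: "a \<in> space ?L" "l \<in> {s..<n}" "l \<le> v" "a l < 0" for a l
  proof -
    \<comment> \<open>Moving back along the edge raises only the coordinate at \<open>j\<close>, and
      \<open>j\<close> lies beyond \<open>v\<close> and hence beyond \<open>l\<close>; a negative
      coordinate at \<open>l\<close> stays negative.\<close>
    have "W (S (- t) a) = 0" if "0 \<le> t" for t
      using a v that by (intro W_0[OF S_space, of l]) (auto simp: S_def root_vec_def)
    then have "(\<lambda>t. indicator {0..} t * W (S (- t) a)) = (\<lambda>t. 0)"
      by (auto simp: indicator_def)
    then show ?thesis unfolding W'_def by simp
  qed
  have chamber: "W' a = ennreal (q a) \<and> 0 \<le> q a"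
    if a: "a \<in> space ?L" "\<forall>l\<in>{s..<n}. 0 \<le> a l" for a
  proof -
    have pS: "p (S (- t) a) = p (\<lambda>l. a l - t * root_vec v j l)" for t
      by (rule p) (simp add: S_def)
    have nonneg: "W (S (- t) a) = ennreal (p (\<lambda>l. a l - t * root_vec v j l)) \<and>
        0 \<le> p (\<lambda>l. a l - t * root_vec v j l)" if "t \<in> {0..a v}" for t
    proof -
      have "\<forall>l\<in>{s..<n}. 0 \<le> S (- t) a l"
      proof
        fix l assume "l \<in> {s..<n}"
        then show "0 \<le> S (- t) a l"
          using bspec[OF a(2), of l] v that by (auto simp: S_def root_vec_def)
      qed
      from W_p[OF S_space this] show ?thesis unfolding pS .
    qed
    have zero: "W (S (- t) a) = 0" if "a v < t" for t
      using that v by (intro W_0[OF S_space, of v]) (auto simp: S_def root_vec_def)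
    have "W' a = (\<integral>\<^sup>+t. ennreal (p (\<lambda>l. a l - t * root_vec v j l)) * indicator {0..a v} t \<partial>lborel)"
      unfolding W'_def
      by (intro nn_integral_cong) (auto simp: indicator_def nonneg zero not_le)
    also have "\<dots> = ennreal (q a)"
      by (intro nn_integral_has_integral_lebesgue') (use nonneg q[of a] a in auto)
    finally have "W' a = ennreal (q a)" .
    moreover have "0 \<le> q a"
      using q[of a] a nonneg by (intro has_integral_nonneg[of _ "q a" "{0..a v}"]) auto
    ultimately show ?thesis by simp
  qed
  show ?thesis
    unfolding flow_density_def using W' integral vanish chamber by blast
qed

subsection \<open>The quotient measure\<close>

lemma finite_flow_index: "finite (flow_index s n \<mu>)"
proof (rule finite_subset)
  define m where "m = (\<Sum>i\<in>{s..n}. \<Sum>j\<in>{s..n}. \<mu> i j)"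
  have "\<mu> i j \<le> m" if "i \<in> {s..n}" "j \<in> {s..n}" for i j
  proof -
    have "\<mu> i j \<le> (\<Sum>j\<in>{s..n}. \<mu> i j)" using that by (intro member_le_sum) auto
    also have "\<dots> \<le> m" unfolding m_def using that by (intro member_le_sum[of i _ "\<lambda>i. \<Sum>j\<in>{s..n}. \<mu> i j"]) auto
    finally show ?thesis .
  qed
  then have "k \<le> m" if "k \<le> \<mu> i j" "i \<in> {s..n}" "j \<in> {s..n}" for i j k
    using that by (meson order_trans)
  then show "flow_index s n \<mu> \<subseteq> {s..n} \<times> {s..n} \<times> {1..m}"
    by (auto simp: flow_index_def pos_roots_def)
qed simp

lemma flow_map_edge_vec: "flow_map s n \<mu> y l = (\<Sum>e\<in>flow_index s n \<mu>. y e * edge_vec e l)"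
  unfolding flow_map_def edge_vec_def by (intro sum.cong) auto

lemma point_eq:
  "point s n a l = (if l \<in> {s..<n} then a l else if l = n then - (\<Sum>i\<in>{s..<n}. a i) else 0)"
proof -
  have "point s n a l = (\<Sum>i\<in>{s..<n}. if i = l then a i else 0) - (\<Sum>i\<in>{s..<n}. if l = n then a i else 0)"
    unfolding point_def root_vec_def sum_subtractf[symmetric] by (intro sum.cong) auto
  then show ?thesis by auto
qed

lemma root_space_eq_point:
  assumes "b \<in> root_space s n" "s \<le> n"
  shows "b = point s n b"
proof
  fix l
  have "(\<Sum>v\<in>{s..n}. b v) = b n + (\<Sum>v\<in>{s..<n}. b v)"
    using assms(2) by (simp add: atLeastLessThanSuc_atLeastAtMost[symmetric])
  then show "b l = point s n b l"
    using assms unfolding point_eq root_space_def by auto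
qed

lemma root_vec_root_space: "s \<le> i \<Longrightarrow> i < j \<Longrightarrow> j \<le> n \<Longrightarrow> root_vec i j \<in> root_space s n"
  by (auto simp: root_space_def root_vec_def sum_subtractf of_bool_def)

lemma point_root_space: 
  assumes "s \<le> n" shows "point s n a \<in> root_space s n"
  using assms unfolding root_space_def
  by (auto simp: point_eq atLeastLessThanSuc_atLeastAtMost[symmetric])

lemma flow_map_root_space: "flow_map s n \<mu> y \<in> root_space s n"
proof -
  have r: "edge_vec e \<in> root_space s n" if "e \<in> flow_index s n \<mu>" for e
    using that by (auto simp: edge_vec_def flow_index_def pos_roots_def intro!: root_vec_root_space)
  have "(\<Sum>l\<in>{s..n}. flow_map s n \<mu> y l) = (\<Sum>e\<in>flow_index s n \<mu>. y e * (\<Sum>l\<in>{s..n}. edge_vec e l))"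
    unfolding flow_map_edge_vec by (subst sum.swap) (simp add: sum_distrib_left)
  also have "\<dots> = 0" using r by (intro sum.neutral) (auto simp: root_space_def)
  finally show ?thesis
    using r unfolding root_space_def by (auto simp: flow_map_edge_vec intro!: sum.neutral)
qed

lemma measurable_point [measurable]: "point s n \<in> measurable (lborel_PiM {s..<n}) borel"
  unfolding point_def
proof (rule measurable_coordinatewise_then_product)
  fix l
  have e: "(\<lambda>a. a i * root_vec i n l) \<in> borel_measurable (lborel_PiM {s..<n})" if "i \<in> {s..<n}" for i
    by (rule borel_measurable_times[OF measurable_coordinate[OF that] borel_measurable_const])
  show "(\<lambda>a. \<Sum>i\<in>{s..<n}. a i * root_vec i n l) \<in> borel_measurable (lborel_PiM {s..<n})"
    by (rule borel_measurable_sum) (rule e)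
qed

text \<open>The assumption \<open>sink\<close> provides the edges \<open>(l, n, 1)\<close>, whose
  root vectors form the lattice basis defining \<open>db\<close>. Their flow values can therefore be
  solved for in terms of the netflow and all other flow values.\<close>

locale flow_setup =
  fixes s n :: nat and \<mu> :: "nat \<Rightarrow> nat \<Rightarrow> nat"
  assumes sn: "s \<le> n" and sink: "\<And>l. l \<in> {s..<n} \<Longrightarrow> 0 < \<mu> l n"
begin

abbreviation "FI \<equiv> flow_index s n \<mu>"
abbreviation "L \<equiv> lborel_PiM {s..<n}"
abbreviation "sink_edge \<equiv> (\<lambda>l. (l, n, Suc 0))"
abbreviation "base \<equiv> sink_edge ` {s..<n}"

text \<open>The flow values on these edges are free coordinates on every fibre.\<close>

definition "F = FI - base"

lemma inj_sink_edge: "inj_on sink_edge {s..<n}"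
  by (auto simp: inj_on_def)

lemma base_subset: "base \<subseteq> FI"
  using sink by (auto simp: flow_index_def pos_roots_def Suc_le_eq)

lemma FI_eq: "FI = F \<union> base" and F_disjoint: "F \<inter> base = {}" and finite_F: "finite F"
  using base_subset finite_flow_index by (auto simp: F_def)

lemma edge_cases:
  obtains (F) "e \<in> F" "e \<in> FI"
  | (sink) l where "l \<in> {s..<n}" "e = sink_edge l" "e \<in> FI" "e \<notin> F" "e \<in> base"
  | (out) "e \<notin> FI" "e \<notin> F" "e \<notin> base"
  using FI_eq F_disjoint by blast

lemma sink_edge_mem: "l \<in> {s..<n} \<Longrightarrow> sink_edge l \<in> FI" "l \<in> {s..<n} \<Longrightarrow> sink_edge l \<notin> F"
  using FI_eq F_disjoint by blast+

lemma flow_map_coord: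
  assumes "l \<in> {s..<n}"
  shows "flow_map s n \<mu> y l = y (sink_edge l) + (\<Sum>e\<in>F. y e * edge_vec e l)"
proof -
  have "(\<Sum>e\<in>base. y e * edge_vec e l) = (\<Sum>l'\<in>{s..<n}. if l' = l then y (sink_edge l') else 0)"
    unfolding sum.reindex[OF inj_sink_edge]
    using assms by (intro sum.cong) (auto simp: edge_vec_def root_vec_def)
  then show ?thesis
    using assms unfolding flow_map_edge_vec FI_eq
      sum.union_disjoint[OF finite_F finite_imageI[OF finite_atLeastLessThan] F_disjoint]
    by simp
qed

lemma flow_map_eqI:
  assumes "b \<in> root_space s n" "\<And>l. l \<in> {s..<n} \<Longrightarrow> flow_map s n \<mu> y l = b l"
  shows "flow_map s n \<mu> y = b"
proof -
  have "flow_map s n \<mu> y = point s n (flow_map s n \<mu> y)"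
    by (rule root_space_eq_point[OF flow_map_root_space sn])
  also have "\<dots> = point s n b" using assms(2) by (auto simp: point_eq fun_eq_iff)
  also have "\<dots> = b" by (rule root_space_eq_point[OF assms(1) sn, symmetric])
  finally show ?thesis .
qed

text \<open>The flow with netflow \<open>b\<close> and prescribed values off the edges \<open>(l, n, 1)\<close>.\<close>

definition complete_flow :: "(nat \<Rightarrow> real) \<Rightarrow> (nat \<times> nat \<times> nat \<Rightarrow> real) \<Rightarrow> nat \<times> nat \<times> nat \<Rightarrow> real" where
  "complete_flow b z =
     (\<lambda>e\<in>FI. if e \<in> F then z e else b (fst e) - (\<Sum>e'\<in>F. z e' * edge_vec e' (fst e)))"

lemma complete_flow_sink:
  "l \<in> {s..<n} \<Longrightarrow> complete_flow b z (sink_edge l) = b l - (\<Sum>e\<in>F. z e * edge_vec e l)"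
  using sink_edge_mem[of l] by (simp add: complete_flow_def)

lemma complete_flow_F: "e \<in> F \<Longrightarrow> complete_flow b z e = z e"
  by (simp add: complete_flow_def FI_eq)

lemma flow_map_complete_flow:
  assumes "b \<in> root_space s n"
  shows "flow_map s n \<mu> (complete_flow b z) = b"
  using assms
proof (rule flow_map_eqI)
  fix l assume "l \<in> {s..<n}"
  then show "flow_map s n \<mu> (complete_flow b z) l = b l"
    unfolding flow_map_coord[OF \<open>l \<in> {s..<n}\<close>]
    by (simp add: complete_flow_sink complete_flow_F del: atLeastLessThan_iff)
qed

lemma measurable_complete_flow [measurable]:
  "(\<lambda>(b, z). complete_flow b z) \<in> measurable (borel \<Otimes>\<^sub>M lborel_PiM F) (lborel_PiM FI)"
  unfolding complete_flow_def split_beta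
proof (rule measurable_restrict)
  fix e :: "nat \<times> nat \<times> nat"
  have [measurable]: "(\<lambda>x. snd x e') \<in> borel_measurable (borel \<Otimes>\<^sub>M lborel_PiM F)" if "e' \<in> F" for e'
    by (rule measurable_compose[OF measurable_snd measurable_coordinate[OF that]])
  have [measurable]: "(\<lambda>x. \<Sum>e'\<in>F. snd x e' * edge_vec e' (fst e)) \<in> borel_measurable (borel \<Otimes>\<^sub>M lborel_PiM F)"
    by (rule borel_measurable_sum) measurable
  have "(\<lambda>x :: (nat \<Rightarrow> real) \<times> (nat \<times> nat \<times> nat \<Rightarrow> real). fst x (fst e)) \<in> borel_measurable (borel \<Otimes>\<^sub>M lborel_PiM F)"
    by (rule measurable_compose[OF measurable_fst measurable_product_coordinates])
  then show "(\<lambda>x. if e \<in> F then snd x e else fst x (fst e) - (\<Sum>e'\<in>F. snd x e' * edge_vec e' (fst e)))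
      \<in> measurable (borel \<Otimes>\<^sub>M lborel_PiM F) lborel"
    by (cases "e \<in> F") auto
qed

lemma measurable_complete_flow_snd [measurable]:
  "complete_flow b \<in> measurable (lborel_PiM F) (lborel_PiM FI)"
  using measurable_compose[OF measurable_Pair1' measurable_complete_flow, of b] by simp

text \<open>An explicit \<open>du/db\<close>: Lebesgue measure in the free coordinates, transported
  to the fibre. It serves as the witness for the choice in \<open>quotient_measure\<close>.\<close>

definition fibre_measure :: "(nat \<Rightarrow> real) \<Rightarrow> (nat \<times> nat \<times> nat \<Rightarrow> real) measure" where
  "fibre_measure b = distr (lborel_PiM F) (lborel_PiM FI) (complete_flow b)"

text \<open>Adding \<open>u\<close> to a flow shifts its free coordinates by the restriction of
  \<open>u\<close> and its netflow by that of \<open>u\<close>, so translation invariance on the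
  free coordinates suffices.\<close>

lemma fibre_measure_translate:
  "fibre_measure (\<lambda>v. b v + flow_map s n \<mu> u v) =
     distr (fibre_measure b) (lborel_PiM FI) (\<lambda>y. \<lambda>t\<in>FI. y t + u t)"
proof -
  let ?b = "\<lambda>v. b v + flow_map s n \<mu> u v"
  have [measurable]: "(\<lambda>y. \<lambda>t\<in>FI. y t + u t) \<in> measurable (lborel_PiM FI) (lborel_PiM FI)"
    by measurable
  have [measurable]: "(\<lambda>z. \<lambda>t\<in>F. z t + u t) \<in> measurable (lborel_PiM F) (lborel_PiM F)"
    by measurable
  have eq: "complete_flow ?b (\<lambda>t\<in>F. z t + u t) = (\<lambda>t\<in>FI. complete_flow b z t + u t)" for z
  proof
    fix e
    show "complete_flow ?b (\<lambda>t\<in>F. z t + u t) e = (\<lambda>t\<in>FI. complete_flow b z t + u t) e"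
    proof (cases e rule: edge_cases)
      case F
      then show ?thesis by (simp add: complete_flow_F)
    next
      case (sink l)
      then show ?thesis
        by (simp add: complete_flow_sink flow_map_coord distrib_right sum.distrib
            del: atLeastLessThan_iff)
    next
      case out
      then show ?thesis by (simp add: complete_flow_def)
    qed
  qed
  have "fibre_measure ?b = distr (distr (lborel_PiM F) (lborel_PiM F) (\<lambda>z. \<lambda>t\<in>F. z t + u t))
      (lborel_PiM FI) (complete_flow ?b)"
    unfolding fibre_measure_def by (simp only: distr_lborel_PiM_shift[OF finite_F])
  also have "\<dots> = distr (lborel_PiM F) (lborel_PiM FI) (\<lambda>z. \<lambda>t\<in>FI. complete_flow b z t + u t)"
    by (subst distr_distr) (auto simp: comp_def eq)
  also have "\<dots> = distr (fibre_measure b) (lborel_PiM FI) (\<lambda>y. \<lambda>t\<in>FI. y t + u t)"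
    unfolding fibre_measure_def by (subst distr_distr) (auto simp: comp_def)
  finally show ?thesis .
qed

lemma emeasure_fibre_measure:
  "A \<in> sets (lborel_PiM FI) \<Longrightarrow>
    emeasure (fibre_measure b) A = (\<integral>\<^sup>+z. indicator A (complete_flow b z) \<partial>lborel_PiM F)"
  unfolding fibre_measure_def
  by (subst nn_integral_indicator[symmetric], simp, subst nn_integral_distr) auto

text \<open>The disintegration rests on Fubini: for fixed free values, passing from the netflow to
  the flow on the edges \<open>(l, n, 1)\<close> is a translation followed by a relabelling, hence
  preserves Lebesgue measure.\<close>

lemma is_quotient_measure_fibre_measure: "is_quotient_measure s n \<mu> fibre_measure"
  unfolding is_quotient_measure_def flow_measure_def
proof (intro conjI ballI allI)
  fix b assume b: "b \<in> root_space s n"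
  show "sets (fibre_measure b) = sets (lborel_PiM FI)" by (simp add: fibre_measure_def)
  let ?X = "space (lborel_PiM FI) - flow_fibre s n \<mu> b"
  show "emeasure (fibre_measure b) ?X = 0"
  \<comment> \<open>For \<open>b\<close> in the hyperplane every completed flow lies in the fibre.
    The other case is settled by the convention that \<open>emeasure\<close> is 0 on sets that are
    not measurable.\<close>
  proof (cases "?X \<in> sets (lborel_PiM FI)")
    case True
    have "complete_flow b z \<in> flow_fibre s n \<mu> b" for z
      using flow_map_complete_flow[OF b] by (auto simp: flow_fibre_def complete_flow_def)
    then show ?thesis by (simp add: emeasure_fibre_measure[OF True])
  qed (simp add: fibre_measure_def emeasure_notin_sets)
next
  fix b u assume "b \<in> root_space s n"
  show "fibre_measure (\<lambda>v. b v + flow_map s n \<mu> u v) =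
     distr (fibre_measure b) (lborel_PiM FI) (\<lambda>y. \<lambda>t\<in>FI. y t + u t)"
    by (rule fibre_measure_translate)
next
  fix A assume A [measurable]: "A \<in> sets (lborel_PiM FI)"
  interpret F: sigma_finite_measure "lborel_PiM F" by (rule sigma_finite_lborel_PiM[OF finite_F])
  interpret L: sigma_finite_measure L by (rule sigma_finite_lborel_PiM) simp
  interpret P: pair_sigma_finite L "lborel_PiM F" ..
  have meas: "(\<lambda>b. emeasure (fibre_measure b) A) \<in> borel_measurable borel"
    unfolding emeasure_fibre_measure[OF A] by measurable
  then show "(\<lambda>b. emeasure (fibre_measure b) A) \<in> borel_measurable (root_space_measure s n)"
    by (simp add: root_space_measure_def)
  have merge: "(\<integral>\<^sup>+a. indicator A (complete_flow (point s n a) z) \<partial>L) =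
      (\<integral>\<^sup>+x. indicator A (merge F base (z, x)) \<partial>lborel_PiM base)"
    if z: "z \<in> space (lborel_PiM F)" for z
  proof -
    \<comment> \<open>The flow with free values \<open>z\<close> and value \<open>c l\<close> on
      \<open>(l, n, 1)\<close>: the common form through which both integrals are compared.\<close>
    define U where "U c = (\<lambda>e\<in>FI. if e \<in> F then z e else c (fst e))" for c :: "nat \<Rightarrow> real"
    have [measurable]: "U \<in> measurable L (lborel_PiM FI)"
      unfolding U_def
    proof (rule measurable_restrict)
      fix e assume e: "e \<in> FI"
      show "(\<lambda>c. if e \<in> F then z e else c (fst e)) \<in> measurable L lborel"
      proof (cases "e \<in> F")
        case False
        then have "fst e \<in> {s..<n}" using e by (cases e rule: edge_cases) auto
        then show ?thesis using False measurable_coordinate[of "fst e" "{s..<n}"] by simp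
      qed simp
    qed
    have U1: "complete_flow (point s n a) z = U (\<lambda>l\<in>{s..<n}. a l + - (\<Sum>e\<in>F. z e * edge_vec e l))" for a
    proof
      fix e
      show "complete_flow (point s n a) z e = U (\<lambda>l\<in>{s..<n}. a l + - (\<Sum>e\<in>F. z e * edge_vec e l)) e"
        by (cases e rule: edge_cases) (auto simp: U_def complete_flow_def point_eq)
    qed
    have U2: "merge F base (z, x) = U (\<lambda>l\<in>{s..<n}. x (sink_edge l))" for x
    proof
      fix e
      show "merge F base (z, x) e = U (\<lambda>l\<in>{s..<n}. x (sink_edge l)) e"
        by (cases e rule: edge_cases) (auto simp: U_def merge_def)
    qed
    have "(\<integral>\<^sup>+a. indicator A (complete_flow (point s n a) z) \<partial>L) = (\<integral>\<^sup>+c. indicator A (U c) \<partial>L)"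
      unfolding U1
      by (rule nn_integral_lborel_PiM_shift[where f = "\<lambda>c. indicator A (U c)"]) auto
    also have "\<dots> = (\<integral>\<^sup>+x. indicator A (merge F base (z, x)) \<partial>lborel_PiM base)"
      unfolding U2
      by (rule nn_integral_lborel_PiM_reindex[where f = "\<lambda>c. indicator A (U c)", OF _ inj_sink_edge, symmetric]) auto
    finally show ?thesis .
  qed
  have "(\<integral>\<^sup>+b. emeasure (fibre_measure b) A \<partial>root_space_measure s n) =
      (\<integral>\<^sup>+a. emeasure (fibre_measure (point s n a)) A \<partial>L)"
    unfolding root_space_measure_def by (rule nn_integral_distr[OF measurable_point]) (use meas in simp)
  also have "\<dots> = (\<integral>\<^sup>+a. \<integral>\<^sup>+z. indicator A (complete_flow (point s n a) z) \<partial>lborel_PiM F \<partial>L)"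
    unfolding emeasure_fibre_measure[OF A] ..
  also have "\<dots> = (\<integral>\<^sup>+z. \<integral>\<^sup>+a. indicator A (complete_flow (point s n a) z) \<partial>L \<partial>lborel_PiM F)"
    by (rule P.Fubini'[symmetric]) measurable
  also have "\<dots> = (\<integral>\<^sup>+z. \<integral>\<^sup>+x. indicator A (merge F base (z, x)) \<partial>lborel_PiM base \<partial>lborel_PiM F)"
    by (intro nn_integral_cong merge)
  also have "\<dots> = (\<integral>\<^sup>+y. indicator A y \<partial>lborel_PiM (F \<union> base))"
    using A unfolding FI_eq
    by (intro product_sigma_finite.product_nn_integral_fold[OF product_sigma_finite_lborel F_disjoint finite_F, symmetric]) auto
  also have "\<dots> = emeasure (lborel_PiM FI) A"
    using A unfolding FI_eq by simp
  finally show "emeasure (lborel_PiM FI) A = (\<integral>\<^sup>+b. emeasure (fibre_measure b) A \<partial>root_space_measure s n)" ..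
qed

end

section \<open>Fibre volumes and densities of the netflow map\<close>

context flow_setup
begin

lemma point_net: "point s n (net s n FI y) = flow_map s n \<mu> y"
proof (rule flow_map_eqI[symmetric])
  show "point s n (net s n FI y) \<in> root_space s n" by (rule point_root_space[OF sn])
qed (auto simp: point_eq net_def flow_map_edge_vec)

lemma flow_fibre_point:
  assumes "a \<in> space L"
  shows "flow_fibre s n \<mu> (point s n a) = {y \<in> space (lborel_PiM FI). net s n FI y = a}"
proof -
  have "flow_map s n \<mu> y = point s n a \<longleftrightarrow> net s n FI y = a" for y
  proof
    assume *: "flow_map s n \<mu> y = point s n a"
    show "net s n FI y = a"
    proof
      fix l
      show "net s n FI y l = a l"
        using fun_cong[OF *, of l] assms
        by (cases "l \<in> {s..<n}") (auto simp: net_def flow_map_edge_vec point_eq space_PiM PiE_iff extensional_def)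
    qed
  qed (use point_net in metis)
  then show ?thesis by (auto simp: flow_fibre_def space_PiM)
qed

lemma sets_flow_fibre:
  assumes "a \<in> space L"
  shows "flow_fibre s n \<mu> (point s n a) \<in> sets (lborel_PiM FI)"
proof -
  have "{a} = (\<Pi>\<^sub>E l\<in>{s..<n}. {a l})"
    using assms by (simp add: space_PiM PiE_singleton PiE_iff)
  also have "\<dots> \<in> sets L" by (intro sets_PiM_I_finite) auto
  finally have "net s n FI -` {a} \<inter> space (lborel_PiM FI) \<in> sets (lborel_PiM FI)"
    by (rule measurable_sets[OF measurable_net])
  also have "net s n FI -` {a} \<inter> space (lborel_PiM FI) = flow_fibre s n \<mu> (point s n a)"
    unfolding flow_fibre_point[OF assms] by auto
  finally show ?thesis .
qed

definition "Orth = orthant FI \<inter> space (lborel_PiM FI)"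

lemma sets_Orth [measurable]: "Orth \<in> sets (lborel_PiM FI)"
  unfolding Orth_def by (rule orthant_measurable[OF finite_flow_index])

lemma flow_polytope_eq: "flow_polytope s n \<mu> b = Orth \<inter> flow_fibre s n \<mu> b"
  by (auto simp: flow_polytope_def flow_fibre_def Orth_def orthant_def space_PiM)

section \<open>Volumes with respect to an arbitrary quotient measure\<close>

context
  fixes \<nu> assumes \<nu>: "is_quotient_measure s n \<mu> \<nu>"
begin

lemma sets_quotient: "b \<in> root_space s n \<Longrightarrow> sets (\<nu> b) = sets (lborel_PiM FI)"
  using \<nu> by (simp add: is_quotient_measure_def flow_measure_def)

lemma space_quotient: "b \<in> root_space s n \<Longrightarrow> space (\<nu> b) = space (lborel_PiM FI)"
  by (intro sets_eq_imp_space_eq sets_quotient)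

lemma AE_quotient_fibre:
  assumes "a \<in> space L"
  shows "AE y in \<nu> (point s n a). y \<in> flow_fibre s n \<mu> (point s n a)"
proof (rule AE_I)
  note b = point_root_space[OF sn, of a]
  show "emeasure (\<nu> (point s n a)) (space (lborel_PiM FI) - flow_fibre s n \<mu> (point s n a)) = 0"
    using \<nu> b by (simp add: is_quotient_measure_def flow_measure_def)
  show "space (lborel_PiM FI) - flow_fibre s n \<mu> (point s n a) \<in> sets (\<nu> (point s n a))"
    unfolding sets_quotient[OF b] using sets_flow_fibre[OF assms] by auto
  show "{y \<in> space (\<nu> (point s n a)). y \<notin> flow_fibre s n \<mu> (point s n a)} \<subseteq>
      space (lborel_PiM FI) - flow_fibre s n \<mu> (point s n a)"
    unfolding space_quotient[OF b] by auto
qed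

text \<open>The measure is carried by the fibre, so only the traces of the sets on it count.\<close>

lemma emeasure_quotient_cong:
  assumes "a \<in> space L" "A \<in> sets (lborel_PiM FI)" "B \<in> sets (lborel_PiM FI)"
    "A \<inter> flow_fibre s n \<mu> (point s n a) = B \<inter> flow_fibre s n \<mu> (point s n a)"
  shows "emeasure (\<nu> (point s n a)) A = emeasure (\<nu> (point s n a)) B"
proof (rule emeasure_eq_AE)
  show "AE y in \<nu> (point s n a). y \<in> A \<longleftrightarrow> y \<in> B"
    using AE_quotient_fibre[OF assms(1)] by eventually_elim (use assms(4) in blast)
qed (use assms sets_quotient[OF point_root_space[OF sn]] in auto)

definition "V a = emeasure (\<nu> (point s n a)) Orth"

text \<open>For each measurable \<open>C\<close>, the part of the orthant with netflow in
  \<open>C\<close> is measured in two ways: the disintegration gives the integral of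
  \<open>V\<close> over \<open>C\<close>, the density property that of \<open>W\<close>. Equality
  holds only almost everywhere, since disintegration does not see single fibres.\<close>

lemma V_AE:
  assumes "W \<in> borel_measurable L"
    and W_int: "\<And>g :: _ \<Rightarrow> ennreal. g \<in> borel_measurable L \<Longrightarrow>
        (\<integral>\<^sup>+y. indicator (orthant FI) y * g (net s n FI y) \<partial>lborel_PiM FI) = (\<integral>\<^sup>+a. W a * g a \<partial>L)"
  shows "AE a in L. V a = W a"
proof -
  note assms(1) [measurable]
  interpret L: sigma_finite_measure L by (rule sigma_finite_lborel_PiM) simp
  have meas: "(\<lambda>b. emeasure (\<nu> b) A) \<in> borel_measurable borel"
    and disint: "emeasure (lborel_PiM FI) A = (\<integral>\<^sup>+a. emeasure (\<nu> (point s n a)) A \<partial>L)"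
    if A: "A \<in> sets (lborel_PiM FI)" for A
  proof -
    show meas: "(\<lambda>b. emeasure (\<nu> b) A) \<in> borel_measurable borel"
      using \<nu> A by (simp add: is_quotient_measure_def flow_measure_def root_space_measure_def)
    have "emeasure (lborel_PiM FI) A = (\<integral>\<^sup>+b. emeasure (\<nu> b) A \<partial>root_space_measure s n)"
      using \<nu> A by (simp add: is_quotient_measure_def flow_measure_def)
    also have "\<dots> = (\<integral>\<^sup>+a. emeasure (\<nu> (point s n a)) A \<partial>L)"
      unfolding root_space_measure_def by (rule nn_integral_distr[OF measurable_point]) (use meas in simp)
    finally show "emeasure (lborel_PiM FI) A = (\<integral>\<^sup>+a. emeasure (\<nu> (point s n a)) A \<partial>L)" .
  qed
  have V [measurable]: "V \<in> borel_measurable L"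
    unfolding V_def by (rule measurable_compose[OF measurable_point meas[OF sets_Orth]])
  have "density L V = density L W"
  proof (rule measure_eqI)
    fix C assume "C \<in> sets (density L V)"
    then have C [measurable]: "C \<in> sets L" by simp
    \<comment> \<open>The fibre over \<open>a\<close> meets \<open>A\<close> in its whole
      nonnegative part if \<open>a\<close> is in \<open>C\<close>, and not at all otherwise.\<close>
    define A where "A = Orth \<inter> (net s n FI -` C \<inter> space (lborel_PiM FI))"
    have A: "A \<in> sets (lborel_PiM FI)"
      unfolding A_def by (intro sets.Int sets_Orth measurable_sets[OF measurable_net C])
    have "emeasure (\<nu> (point s n a)) A = V a * indicator C a" if a: "a \<in> space L" for a
    proof (cases "a \<in> C")
      case True
      have "emeasure (\<nu> (point s n a)) A = emeasure (\<nu> (point s n a)) Orth"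
        using True by (intro emeasure_quotient_cong[OF a A sets_Orth]) (auto simp: A_def flow_fibre_point[OF a])
      then show ?thesis using True by (simp add: V_def)
    next
      case False
      have "emeasure (\<nu> (point s n a)) A = emeasure (\<nu> (point s n a)) {}"
        using False by (intro emeasure_quotient_cong[OF a A sets.empty_sets]) (auto simp: A_def flow_fibre_point[OF a])
      then show ?thesis using False by simp
    qed
    then have "emeasure (density L V) C = (\<integral>\<^sup>+a. emeasure (\<nu> (point s n a)) A \<partial>L)"
      by (subst emeasure_density) (auto intro!: nn_integral_cong)
    also have "\<dots> = (\<integral>\<^sup>+y. indicator A y \<partial>lborel_PiM FI)"
      using A disint[OF A] by simp
    also have "\<dots> = (\<integral>\<^sup>+y. indicator (orthant FI) y * indicator C (net s n FI y) \<partial>lborel_PiM FI)"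
      by (intro nn_integral_cong) (auto simp: A_def Orth_def indicator_def)
    also have "\<dots> = (\<integral>\<^sup>+a. W a * indicator C a \<partial>L)" by (rule W_int) simp
    also have "\<dots> = emeasure (density L W) C" by (simp add: emeasure_density)
    finally show "emeasure (density L V) C = emeasure (density L W) C" .
  qed simp
  then show ?thesis by (intro L.density_unique V assms)
qed

lemma emeasure_quotient_translate:
  assumes "A \<in> sets (lborel_PiM FI)" "b \<in> root_space s n"
  shows "emeasure (\<nu> (\<lambda>v. b v + flow_map s n \<mu> u v)) A =
    emeasure (\<nu> b) {y \<in> space (lborel_PiM FI). (\<lambda>t\<in>FI. y t + u t) \<in> A}"
proof -
  have "(\<lambda>y. \<lambda>t\<in>FI. y t + u t) \<in> measurable (lborel_PiM FI) (lborel_PiM FI)"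
    by measurable
  then have m: "(\<lambda>y. \<lambda>t\<in>FI. y t + u t) \<in> measurable (\<nu> b) (lborel_PiM FI)"
    using measurable_cong_sets[OF sets_quotient[OF assms(2)] refl] by blast
  have "\<nu> (\<lambda>v. b v + flow_map s n \<mu> u v) = distr (\<nu> b) (lborel_PiM FI) (\<lambda>y. \<lambda>t\<in>FI. y t + u t)"
    using \<nu> assms(2) by (simp add: is_quotient_measure_def flow_measure_def)
  then show ?thesis
    using assms by (simp add: emeasure_distr[OF m] space_quotient vimage_def Int_def conj_commute)
qed

text \<open>
  The almost everywhere equality is upgraded to an equality on the closed chamber: translating by
  nonnegative flows \<open>u k\<close> that decrease to 0 writes the fibre volume at \<open>a\<close> as the limit of
  fibre volumes at good points \<open>c k\<close>.
\<close>

lemma quotient_volume: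
  assumes dens: "flow_density s n v FI p" and p: "hom_poly {s..<n} d p"
    and a: "\<And>l. l \<in> {s..<n} \<Longrightarrow> 0 \<le> a l"
  shows "measure (\<nu> (point s n a)) (flow_polytope s n \<mu> (point s n a)) = p a"
proof -
  \<comment> \<open>The facts about \<open>W\<close> concern elements of the product space only, so
    \<open>a\<close> is made undefined off \<open>{s..<n}\<close>; neither \<open>point\<close> nor
    \<open>p\<close> notices.\<close>
  define a' where "a' = restrict a {s..<n}"
  have a': "a' \<in> space L" "point s n a' = point s n a" "\<And>l. l \<in> {s..<n} \<Longrightarrow> a' l = a l"
    by (auto simp: a'_def space_PiM point_eq fun_eq_iff)
  have pa': "p a' = p a" by (rule hom_poly_cong_arg[OF p]) (rule a')
  note b = point_root_space[OF sn, of a']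
  obtain W where W: "W \<in> borel_measurable L"
    and W_int: "\<And>g :: _ \<Rightarrow> ennreal. g \<in> borel_measurable L \<Longrightarrow>
        (\<integral>\<^sup>+y. indicator (orthant FI) y * g (net s n FI y) \<partial>lborel_PiM FI) = (\<integral>\<^sup>+a. W a * g a \<partial>L)"
    and W_p: "\<And>a. a \<in> space L \<Longrightarrow> (\<forall>l\<in>{s..<n}. 0 \<le> a l) \<Longrightarrow> W a = ennreal (p a) \<and> 0 \<le> p a"
    using dens unfolding flow_density_def by blast
  obtain N where N: "{c \<in> space L. V c \<noteq> W c} \<subseteq> N" "emeasure L N = 0" "N \<in> sets L"
    using V_AE[OF W W_int] by (auto elim: AE_E)
  \<comment> \<open>The boxes have positive measure, so none lies in the null set \<open>N\<close>.
    In each coordinate the intervals are adjacent and descend to \<open>a l\<close>, so any choice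
    of \<open>c k\<close> in \<open>box k\<close> is decreasing with limit \<open>a\<close>.\<close>
  define box where "box k = (\<Pi>\<^sub>E l\<in>{s..<n}. {a l + (1/2) ^ Suc k<..a l + (1/2) ^ k})" for k :: nat
  have "\<exists>c\<in>box k. V c = W c" for k
  proof (rule ccontr)
    assume "\<not> ?thesis"
    then have "box k \<subseteq> N" using N(1) by (auto simp: box_def space_PiM)
    then have "emeasure L (box k) \<le> 0" using emeasure_mono[OF _ N(3)] N(2) by metis
    moreover have "emeasure L (box k) = (\<Prod>l\<in>{s..<n}. emeasure lborel {a l + (1/2) ^ Suc k<..a l + (1/2) ^ k})"
      unfolding box_def by (rule product_sigma_finite.emeasure_PiM[OF product_sigma_finite_lborel]) auto
    ultimately show False by (auto simp: field_simps)
  qed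
  then obtain c where c: "\<And>k. c k \<in> box k" "\<And>k. V (c k) = W (c k)" by metis
  have c_space: "c k \<in> space L" for k using c(1)[of k] by (auto simp: box_def space_PiM)
  have c_bounds: "a l + (1/2) ^ Suc k < c k l" "c k l \<le> a l + (1/2) ^ k" if "l \<in> {s..<n}" for k l
    using c(1)[of k] that by (auto simp: box_def PiE_iff)
  have c_nonneg: "\<forall>l\<in>{s..<n}. 0 \<le> c k l" for k
    using c_bounds(1)[of _ k] a by (smt (verit, best) zero_less_power half_gt_zero zero_less_one)
  have c_lim: "(\<lambda>k. c k l) \<longlonglongrightarrow> a l" if "l \<in> {s..<n}" for l
  proof (rule real_tendsto_sandwich)
    have "a l \<le> c k l" for k
      using c_bounds(1)[OF that, of k] zero_less_power[of "1/2::real" "Suc k"] by linarith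
    then show "\<forall>\<^sub>F k in sequentially. a l \<le> c k l" by simp
    show "\<forall>\<^sub>F k in sequentially. c k l \<le> a l + (1/2) ^ k" using c_bounds(2)[OF that] by simp
    have "(\<lambda>k. (1/2::real) ^ k) \<longlonglongrightarrow> 0" by (rule LIMSEQ_realpow_zero) auto
    from tendsto_add[OF tendsto_const[of "a l"] this]
    show "(\<lambda>k. a l + (1/2) ^ k) \<longlonglongrightarrow> a l" by simp
    show "(\<lambda>k. a l) \<longlonglongrightarrow> a l" by simp
  qed
  \<comment> \<open>The flow on the edges \<open>(l, n, 1)\<close> whose netflow is
    \<open>c k - a\<close>.\<close>
  define u where "u k e = (if e \<in> base then c k (fst e) - a (fst e) else 0)" for k e
  have u_sink: "u k (sink_edge l) = c k l - a l" if "l \<in> {s..<n}" for k l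
    using that by (auto simp: u_def)
  have u_F: "u k e = 0" if "e \<in> F" for k e
    using that F_disjoint by (auto simp: u_def)
  have u_decseq: "u (Suc k) e \<le> u k e" for k e
    using c_bounds(2)[of "fst e" "Suc k"] c_bounds(1)[of "fst e" k] by (auto simp: u_def)
  have u_nonneg: "0 \<le> u k e" for k e
  proof -
    have "a l \<le> c k l" if "l \<in> {s..<n}" for l
      using c_bounds(1)[OF that, of k] zero_less_power[of "1/2::real" "Suc k"] by linarith
    then show ?thesis by (auto simp: u_def)
  qed
  have u_lim: "(\<lambda>k. u k e) \<longlonglongrightarrow> 0" for e
    using c_lim[of "fst e", THEN tendsto_diff, OF _ tendsto_const[of "a (fst e)"]]
    by (cases "e \<in> base") (auto simp: u_def)
  \<comment> \<open>Translation by \<open>u k\<close> turns the volume over \<open>c k\<close> into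
    the measure, on the fixed fibre over \<open>a\<close>, of the orthant enlarged by
    \<open>u k\<close>. These sets decrease to the orthant itself.\<close>
  define Ok where "Ok k = {y \<in> space (lborel_PiM FI). (\<lambda>t\<in>FI. y t + u k t) \<in> Orth}" for k
  have Ok_iff: "y \<in> Ok k \<longleftrightarrow> y \<in> space (lborel_PiM FI) \<and> (\<forall>t\<in>FI. 0 \<le> y t + u k t)" for y k
    by (auto simp: Ok_def Orth_def orthant_def space_PiM)
  have Ok_sets: "Ok k \<in> sets (lborel_PiM FI)" for k
  proof -
    have "(\<lambda>y. \<lambda>t\<in>FI. y t + u k t) \<in> measurable (lborel_PiM FI) (lborel_PiM FI)" by measurable
    from measurable_sets[OF this sets_Orth] show ?thesis
      by (simp add: Ok_def vimage_def Int_def conj_commute)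
  qed
  have V_c: "V (c k) = emeasure (\<nu> (point s n a')) (Ok k)" for k
  proof -
    have "point s n (c k) = (\<lambda>v. point s n a' v + flow_map s n \<mu> (u k) v)"
    proof -
      have "flow_map s n \<mu> (u k) = point s n (\<lambda>l. c k l - a l)"
        by (rule flow_map_eqI[OF point_root_space[OF sn]])
          (simp add: flow_map_coord u_sink u_F point_eq del: atLeastLessThan_iff)
      then show ?thesis unfolding a'(2)
        by (auto simp: point_eq fun_eq_iff sum_subtractf)
    qed
    then show ?thesis unfolding V_def Ok_def by (simp add: emeasure_quotient_translate[OF sets_Orth b])
  qed
  have "(\<lambda>k. emeasure (\<nu> (point s n a')) (Ok k)) \<longlonglongrightarrow> emeasure (\<nu> (point s n a')) (\<Inter>k. Ok k)"
  proof (rule Lim_emeasure_decseq)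
    show "range Ok \<subseteq> sets (\<nu> (point s n a'))" using Ok_sets by (auto simp: sets_quotient[OF b])
    show "decseq Ok" unfolding decseq_Suc_iff
    proof (intro allI subsetI)
      fix k y assume y: "y \<in> Ok (Suc k)"
      have "0 \<le> y t + u k t" if "t \<in> FI" for t
      proof -
        have "0 \<le> y t + u (Suc k) t" using y that by (simp add: Ok_iff)
        also have "\<dots> \<le> y t + u k t" by (intro add_left_mono u_decseq)
        finally show ?thesis .
      qed
      then show "y \<in> Ok k" using y by (simp add: Ok_iff)
    qed
    \<comment> \<open>Continuity from above needs finite measure; it comes from the good points,
      where the volume equals the real number \<open>p (c k)\<close>.\<close>
    show "emeasure (\<nu> (point s n a')) (Ok k) \<noteq> \<infinity>" for k
      using W_p[OF c_space c_nonneg, of k] by (simp add: V_c[symmetric] c(2))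
  qed
  moreover have "(\<Inter>k. Ok k) = Orth"
  proof (intro equalityI subsetI)
    fix y assume y: "y \<in> (\<Inter>k. Ok k)"
    have "0 \<le> y t" if "t \<in> FI" for t
    proof -
      have "(\<lambda>k. y t + u k t) \<longlonglongrightarrow> y t" using tendsto_add[OF tendsto_const u_lim] by simp
      then show ?thesis
        by (rule LIMSEQ_le_const) (use y that Ok_iff in blast)
    qed
    then show "y \<in> Orth" using y by (auto simp: Ok_iff Orth_def orthant_def)
  next
    fix y assume "y \<in> Orth"
    then show "y \<in> (\<Inter>k. Ok k)" using u_nonneg by (auto simp: Ok_iff Orth_def orthant_def)
  qed
  moreover have "emeasure (\<nu> (point s n a')) (Ok k) = ennreal (p (c k))" for k
    using W_p[OF c_space c_nonneg, of k] by (simp add: V_c[symmetric] c(2))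
  ultimately have "(\<lambda>k. ennreal (p (c k))) \<longlonglongrightarrow> emeasure (\<nu> (point s n a')) Orth" by simp
  moreover have "(\<lambda>k. ennreal (p (c k))) \<longlonglongrightarrow> ennreal (p a)"
    by (intro tendsto_ennrealI hom_poly_tendsto[OF p] c_lim)
  ultimately have "emeasure (\<nu> (point s n a')) Orth = ennreal (p a)"
    by (rule LIMSEQ_unique)
  also have "emeasure (\<nu> (point s n a')) Orth = emeasure (\<nu> (point s n a')) (flow_polytope s n \<mu> (point s n a'))"
    unfolding flow_polytope_eq
    by (intro emeasure_quotient_cong a'(1) sets.Int sets_flow_fibre sets_Orth) auto
  finally have "emeasure (\<nu> (point s n a)) (flow_polytope s n \<mu> (point s n a)) = ennreal (p a)"
    unfolding a'(2) .
  moreover have "0 \<le> p a" using W_p[OF a'(1)] a a'(3) pa' by simp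
  ultimately show ?thesis by (simp add: measure_def)
qed

end

text \<open>The choice in \<open>quotient_measure\<close> has the witness
  \<open>fibre_measure\<close>, and the preceding result covers whichever quotient measure is
  chosen.\<close>

lemma flow_volume_eq:
  assumes "flow_density s n v FI p" "hom_poly {s..<n} d p" "\<And>l. l \<in> {s..<n} \<Longrightarrow> 0 \<le> a l"
  shows "flow_volume s n \<mu> (point s n a) = p a"
proof -
  have "is_quotient_measure s n \<mu> (quotient_measure s n \<mu>)"
    unfolding quotient_measure_def by (rule someI[of "is_quotient_measure s n \<mu>", OF is_quotient_measure_fibre_measure])
  from quotient_volume[OF this assms] show ?thesis unfolding flow_volume_def .
qed

text \<open>One direction uses that coordinate half-spaces are closed in the product topology, the
  other approximates by adding \<open>1 / (k + 1)\<close> to every coordinate.\<close>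

lemma point_closure_nice_chamber:
  "point s n a \<in> closure (nice_chamber s n) \<longleftrightarrow> (\<forall>l\<in>{s..<n}. 0 \<le> a l)"
proof
  assume *: "point s n a \<in> closure (nice_chamber s n)"
  show "\<forall>l\<in>{s..<n}. 0 \<le> a l"
  proof
    fix l assume l: "l \<in> {s..<n}"
    have "closed {b :: nat \<Rightarrow> real. 0 \<le> b l}"
      by (intro closed_Collect_le continuous_on_const continuous_on_product_coordinates)
    moreover have "nice_chamber s n \<subseteq> {b. 0 \<le> b l}"
      using l by (auto simp: nice_chamber_def point_eq less_imp_le)
    ultimately have "closure (nice_chamber s n) \<subseteq> {b. 0 \<le> b l}" by (intro closure_minimal)
    then show "0 \<le> a l" using * l by (auto simp: point_eq)
  qed
next
  assume a: "\<forall>l\<in>{s..<n}. 0 \<le> a l"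
  define x where "x k = point s n (\<lambda>l. a l + 1 / real (Suc k))" for k
  have "x k \<in> nice_chamber s n" for k
  proof -
    have "\<forall>i\<in>{s..<n}. 0 < a i + 1 / real (Suc k)"
      using a by (auto intro: add_nonneg_pos)
    then show ?thesis unfolding x_def nice_chamber_def by blast
  qed
  moreover have "x \<longlonglongrightarrow> point s n a"
  proof -
    have "continuous_on UNIV (\<lambda>\<epsilon>. point s n (\<lambda>l. a l + \<epsilon>))"
      unfolding point_def
      by (intro continuous_on_coordinatewise_then_product continuous_intros)
    then have "(\<lambda>k. point s n (\<lambda>l. a l + 1 / real (Suc k))) \<longlonglongrightarrow> point s n (\<lambda>l. a l + 0)"
      using LIMSEQ_inverse_real_of_nat
      by (intro continuous_on_tendsto_compose[where f = "\<lambda>\<epsilon>. point s n (\<lambda>l. a l + \<epsilon>)"])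
        (auto simp: inverse_eq_divide)
    then show ?thesis by (simp add: x_def[abs_def])
  qed
  ultimately show "point s n a \<in> closure (nice_chamber s n)"
    unfolding closure_sequential by blast
qed

text \<open>The density polynomial meets the defining conditions; any other candidate agrees with it
  on the nonnegative orthant and hence everywhere.\<close>

lemma nice_volume_poly_eq:
  assumes dens: "flow_density s n v FI p"
    and p: "hom_poly {s..<n} ((\<Sum>(i, j)\<in>pos_roots s n. \<mu> i j) - (n - s)) p"
  shows "nice_volume_poly s n \<mu> = p"
  unfolding nice_volume_poly_def
proof (rule the_equality, intro conjI allI impI)
  show "homogeneous_poly {s..<n} ((\<Sum>(i, j)\<in>pos_roots s n. \<mu> i j) - (n - s)) p"
    by (rule hom_poly_imp_homogeneous[OF _ p]) simp
  show "p a = flow_volume s n \<mu> (point s n a)" if "point s n a \<in> closure (nice_chamber s n)" for a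
    using that unfolding point_closure_nice_chamber by (intro flow_volume_eq[symmetric, OF dens p]) auto
next
  fix q
  assume q: "homogeneous_poly {s..<n} ((\<Sum>(i, j)\<in>pos_roots s n. \<mu> i j) - (n - s)) q \<and>
    (\<forall>a. point s n a \<in> closure (nice_chamber s n) \<longrightarrow> q a = flow_volume s n \<mu> (point s n a))"
  have "poly_fun q"
    using q homogeneous_imp_hom_poly[of "{s..<n}"] hom_poly_imp_poly_fun by blast
  moreover have "poly_fun (\<lambda>a. - 1 * p a)" using hom_poly_imp_poly_fun[OF p] by (rule poly_fun_scale)
  ultimately have "poly_fun (\<lambda>a. q a + - 1 * p a)" by (rule poly_fun.add)
  moreover have "q a + - 1 * p a = 0" if "\<And>l. l \<in> {s..<n} \<Longrightarrow> 0 \<le> a l" for a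
    using q that flow_volume_eq[OF dens p, of a] by (simp add: point_closure_nice_chamber)
  ultimately have "q a + - 1 * p a = 0" for a
    using poly_fun_eq_0[of "\<lambda>a. q a + - 1 * p a" "{s..<n}"] by simp
  then show "q = p" by (auto simp: fun_eq_iff)
qed

end

subsection \<open>Inserting the edges\<close>

lemma card_flow_index: "card (flow_index s n \<mu>) = (\<Sum>(i, j)\<in>pos_roots s n. \<mu> i j)"
proof -
  have fin: "finite (pos_roots s n)"
    by (rule finite_subset[of _ "{s..n} \<times> {s..n}"]) (auto simp: pos_roots_def)
  have "flow_index s n \<mu> = (\<lambda>((i, j), k). (i, j, k)) ` (SIGMA (i, j):pos_roots s n. {1..\<mu> i j})"
    by (force simp: flow_index_def)
  moreover have "inj_on (\<lambda>((i, j), k). (i, j, k)) (SIGMA (i, j):pos_roots s n. {1..\<mu> i j})"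
    by (auto simp: inj_on_def)
  ultimately have "card (flow_index s n \<mu>) = card (SIGMA (i, j):pos_roots s n. {1..\<mu> i j})"
    by (simp add: card_image)
  also have "\<dots> = (\<Sum>(i, j)\<in>pos_roots s n. \<mu> i j)"
    using fin by (subst card_SigmaI) (auto intro!: sum.cong)
  finally show ?thesis .
qed

abbreviation sink_edges :: "nat \<Rightarrow> nat \<Rightarrow> (nat \<times> nat \<times> nat) set" where
  "sink_edges s n \<equiv> (\<lambda>l. (l, n, Suc 0)) ` {s..<n}"

definition extra_edges :: "nat \<Rightarrow> nat \<Rightarrow> (nat \<Rightarrow> nat \<Rightarrow> nat) \<Rightarrow> (nat \<times> nat \<times> nat) set" where
  "extra_edges s n \<mu> = flow_index s n \<mu> - sink_edges s n"

lemma (in flow_setup) flow_index_extra: "FI = base \<union> extra_edges s n \<mu>"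
  using base_subset by (auto simp: extra_edges_def)

lemma (in flow_setup) card_extra_edges:
  "card (extra_edges s n \<mu>) + (n - s) = (\<Sum>(i, j)\<in>pos_roots s n. \<mu> i j)"
proof -
  have "card FI = card base + card (extra_edges s n \<mu>)"
    unfolding flow_index_extra using finite_flow_index
    by (intro card_Un_disjoint) (auto simp: extra_edges_def)
  also have "card base = n - s" by (simp add: card_image[OF inj_sink_edge])
  finally show ?thesis unfolding card_flow_index by simp
qed

text \<open>Each insertion integrates over the flow on an edge out of \<open>v\<close>, which
  involves only the variables from \<open>v\<close> on. So one polynomial \<open>q\<close> works for
  all starting vertices \<open>s\<close> at once, which is why \<open>I\<close> is a family.\<close>

lemma flow_density_add_edges:
  assumes "finite N" "\<And>e. e \<in> N \<Longrightarrow> fst e = v \<and> v < fst (snd e) \<and> fst (snd e) \<le> n" "v < n"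
    "\<And>s. finite (I s)" "\<And>s. I s \<inter> N = {}"
    "hom_poly {v..<n} d p" "\<And>s. s \<le> v \<Longrightarrow> flow_density s n v (I s) p"
  shows "\<exists>q. hom_poly {v..<n} (d + card N) q \<and> (\<forall>s\<le>v. flow_density s n v (I s \<union> N) q)"
  using assms(1,2,5)
proof (induction N rule: finite_induct)
  case empty
  then show ?case using assms(6,7) by auto
next
  case (insert e N)
  then obtain q where q: "hom_poly {v..<n} (d + card N) q" "\<And>s. s \<le> v \<Longrightarrow> flow_density s n v (I s \<union> N) q"
    by auto
  obtain j k where e: "e = (v, j, k)" "v < j" "j \<le> n"
    using insert.prems(1)[of e] by (cases e) auto
  obtain q' where q': "hom_poly {v..<n} (Suc (d + card N)) q'"
    "\<And>a. 0 \<le> a v \<Longrightarrow> ((\<lambda>t. q (\<lambda>i. a i - t * root_vec v j i)) has_integral q' a) {0..a v}"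
    using hom_poly_edge_integral[OF q(1), of v j] assms(3) by auto
  have "flow_density s n v (insert (v, j, k) (I s \<union> N)) q'" if s: "s \<le> v" for s
  proof (rule flow_density_insert[OF q(2)[OF s]])
    show "finite (I s \<union> N)" using assms(4) insert.hyps by simp
    show "(v, j, k) \<notin> I s \<union> N" using insert.hyps insert.prems(2)[of s] e by auto
    show "q a = q b" if "\<And>l. l \<in> {s..<n} \<Longrightarrow> a l = b l" for a b
      using that s by (intro hom_poly_cong_arg[OF q(1)]) auto
    show "((\<lambda>t. q (\<lambda>l. a l - t * root_vec v j l)) has_integral q' a) {0..a v}"
      if "\<forall>l\<in>{s..<n}. 0 \<le> a l" for a
      using that s assms(3) by (intro q'(2)) auto
  qed (use s e in auto)
  then show ?case using q'(1) insert.hyps e(1) by auto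
qed

text \<open>
  The polynomial does not depend on \<open>s\<close>: this identifies the volume polynomial of the graph on
  \<open>{v..n}\<close> with an intermediate density polynomial of every larger graph.
\<close>

lemma flow_density_exists:
  assumes "v \<le> n"
  shows "\<exists>p. hom_poly {v..<n} (card (extra_edges v n \<mu>)) p \<and>
    (\<forall>s\<le>v. flow_density s n v (sink_edges s n \<union> extra_edges v n \<mu>) p)"
  using assms
proof (induction rule: inc_induct)
  case base
  have "extra_edges n n \<mu> = {}" by (auto simp: extra_edges_def flow_index_def pos_roots_def)
  then show ?case by (intro exI[of _ "\<lambda>a. 1"]) (simp add: hom_poly.const flow_density_base)
next
  case (step v)
  then obtain p where p: "hom_poly {Suc v..<n} (card (extra_edges (Suc v) n \<mu>)) p"
    "\<And>s. s \<le> Suc v \<Longrightarrow> flow_density s n (Suc v) (sink_edges s n \<union> extra_edges (Suc v) n \<mu>) p" by blast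
  define N where "N = {e \<in> extra_edges v n \<mu>. fst e = v}"
  have fin: "finite (extra_edges w n \<mu>)" for w by (simp add: extra_edges_def finite_flow_index)
  have split: "extra_edges v n \<mu> = extra_edges (Suc v) n \<mu> \<union> N"
    unfolding N_def by (auto simp: extra_edges_def flow_index_def pos_roots_def Suc_le_eq image_iff)
  have disj: "(sink_edges s n \<union> extra_edges (Suc v) n \<mu>) \<inter> N = {}" for s
    unfolding N_def using step.hyps
    by (auto simp: extra_edges_def flow_index_def pos_roots_def)
  have "card (extra_edges v n \<mu>) = card (extra_edges (Suc v) n \<mu>) + card N"
    unfolding split using disj fin by (intro card_Un_disjoint) (auto simp: N_def)
  moreover have "\<exists>q. hom_poly {v..<n} (card (extra_edges (Suc v) n \<mu>) + card N) q \<and>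
    (\<forall>s\<le>v. flow_density s n v ((sink_edges s n \<union> extra_edges (Suc v) n \<mu>) \<union> N) q)"
  proof (rule flow_density_add_edges[OF _ _ _ _ disj])
    show "hom_poly {v..<n} (card (extra_edges (Suc v) n \<mu>)) p" by (rule hom_poly_mono[OF p(1)]) auto
    show "flow_density s n v (sink_edges s n \<union> extra_edges (Suc v) n \<mu>) p" if "s \<le> v" for s
      using that by (intro flow_density_mono[OF p(2)]) auto
  qed (use fin step.hyps in \<open>auto simp: N_def extra_edges_def flow_index_def pos_roots_def\<close>)
  ultimately show ?case unfolding split by (simp add: Un_assoc)
qed

section \<open>The edges leaving the first vertex\<close>

lemma has_integral_Beta_fact:
  assumes "(0::real) \<le> x"
  shows "((\<lambda>t. (x - t) ^ A / fact A * (t ^ B / fact B)) has_integral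
     x ^ Suc (A + B) / fact (Suc (A + B))) {0..x}"
proof (induction A arbitrary: B)
  case 0
  show ?case
    using has_integral_divide[OF has_integral_power[OF assms, of B], of "fact B"]
    by (simp add: mult_ac)
next
  case (Suc A)
  \<comment> \<open>Integration by parts trades a power of \<open>x - t\<close> for one of
    \<open>t\<close>. The boundary terms \<open>?g x\<close> and \<open>?g 0\<close> vanish because
    both exponents are positive.\<close>
  let ?g = "\<lambda>t. (x - t) ^ Suc A / fact (Suc A) * (t ^ Suc B / fact (Suc B))"
  let ?d = "\<lambda>t. (x - t) ^ Suc A / fact (Suc A) * (t ^ B / fact B) -
        (x - t) ^ A / fact A * (t ^ Suc B / fact (Suc B))"
  have "(?d has_integral ?g x - ?g 0) {0..x}"
  proof (rule fundamental_theorem_of_calculus[OF assms])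
    fix t :: real
    have pow: "((\<lambda>t. t ^ Suc k / fact (Suc k)) has_real_derivative t ^ k / fact k) (at t)"
      for k and t :: real
    proof -
      have "((\<lambda>t. t ^ Suc k / fact (Suc k)) has_real_derivative real (Suc k) * t ^ k / fact (Suc k)) (at t)"
        by (rule derivative_eq_intros refl | simp)+
      then show ?thesis by (simp add: field_simps del: of_nat_Suc)
    qed
    have "((\<lambda>t. (x - t) ^ Suc A / fact (Suc A)) has_real_derivative (x - t) ^ A / fact A * - 1) (at t)"
      by (rule DERIV_chain2[OF pow]) (rule derivative_eq_intros refl | simp)+
    from DERIV_mult[OF this pow[of B t]]
    have "(?g has_real_derivative ?d t) (at t)"
      by (rule DERIV_cong) (simp only: mult_minus_right mult_1_right, simp only: algebra_simps)
    then show "(?g has_vector_derivative ?d t) (at t within {0..x})"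
      unfolding has_real_derivative_iff_has_vector_derivative[symmetric]
      by (rule has_field_derivative_at_within)
  qed
  from has_integral_add[OF this Suc.IH[of "Suc B"]] show ?case by simp
qed

text \<open>The geometric series of \<open>1 / (1 - t \<partial>_j)\<close>, compared
  coefficientwise.\<close>

lemma compl_op_Cons_sum:
  assumes "poly_fun f"
  shows "compl_op (j # js) k f = (\<lambda>a. \<Sum>l\<le>k. (pderiv_at j ^^ l) (compl_op js (k - l) f) a)"
proof (induction k)
  case (Suc k)
  have "poly_fun ((pderiv_at j ^^ l) (compl_op js i f))" for l i
    by (induction l) (auto intro: poly_fun_compl_op poly_fun_pderiv_at assms)
  then show ?case
    by (simp add: Suc.IH pderiv_at_sum sum.atMost_Suc_shift del: sum.atMost_Suc)
qed auto

text \<open>The shape of the density after \<open>N\<close> edges out of \<open>v\<close> have been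
  inserted, \<open>js\<close> listing the heads of those that do not end in the sink. The bound
  \<open>d\<close> is meant to be the degree of \<open>f\<close>, beyond which the operators
  annihilate \<open>f\<close>.\<close>

definition source_poly ::
    "nat \<Rightarrow> nat \<Rightarrow> nat \<Rightarrow> nat list \<Rightarrow> ((nat \<Rightarrow> real) \<Rightarrow> real) \<Rightarrow> (nat \<Rightarrow> real) \<Rightarrow> real" where
  "source_poly v d N js f a = (\<Sum>k\<le>d. a v ^ (N + k) / fact (N + k) * compl_op js k f a)"

lemma hom_poly_source_poly:
  assumes "hom_poly {Suc v..<n} d f" "v < n"
  shows "hom_poly {v..<n} (N + d) (source_poly v d N js f)"
proof -
  have "hom_poly {v..<n} (N + d) (\<lambda>a. 1 / fact (N + k) * (a v ^ (N + k) * compl_op js k f a))"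
    if "k \<le> d" for k
  proof (rule hom_poly_scale)
    have "hom_poly {v..<n} (d - k) (compl_op js k f)"
      by (rule hom_poly_mono[OF hom_poly_compl_op[OF assms(1)]]) auto
    from hom_poly_power_mult[OF _ this, of v "N + k"]
    show "hom_poly {v..<n} (N + d) (\<lambda>a. a v ^ (N + k) * compl_op js k f a)"
      using assms(2) that by simp
  qed
  then have "hom_poly {v..<n} (N + d)
      (\<lambda>a. \<Sum>k\<le>d. 1 / fact (N + k) * (a v ^ (N + k) * compl_op js k f a))"
    by (intro hom_poly_sum) auto
  then show ?thesis unfolding source_poly_def by (simp add: mult_ac)
qed

text \<open>An edge into the sink moves only the coordinate \<open>v\<close> among the variables
  present, and \<open>compl_op js k f\<close> does not depend on it. Thus only the power of
  \<open>a v\<close> is integrated, the Beta integral with \<open>B = 0\<close>.\<close>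

lemma source_poly_sink_integral:
  assumes f: "hom_poly {Suc v..<n} d f" and "v < n" "0 \<le> a v"
  shows "((\<lambda>t. source_poly v d N js f (\<lambda>l. a l - t * root_vec v n l)) has_integral
     source_poly v d (Suc N) js f a) {0..a v}"
proof -
  have "compl_op js k f (\<lambda>l. a l - t * root_vec v n l) = compl_op js k f a" for k t
    by (rule hom_poly_cong_arg[OF hom_poly_compl_op[OF f]]) (auto simp: root_vec_def)
  then have "(\<lambda>t. source_poly v d N js f (\<lambda>l. a l - t * root_vec v n l)) =
    (\<lambda>t. \<Sum>k\<le>d. (a v - t) ^ (N + k) / fact (N + k) * (t ^ 0 / fact 0) * compl_op js k f a)"
    using assms(2) by (auto simp: source_poly_def root_vec_def)
  moreover have "(\<dots> has_integral
     (\<Sum>k\<le>d. a v ^ Suc (N + k + 0) / fact (Suc (N + k + 0)) * compl_op js k f a)) {0..a v}"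
    by (intro has_integral_sum has_integral_mult_left has_integral_Beta_fact assms(3)) auto
  ultimately show ?thesis by (simp add: source_poly_def)
qed

text \<open>Taylor expansion in the variable \<open>j\<close> produces powers \<open>t^l\<close>
  with \<open>l\<close>-fold derivatives, and the Beta integral merges them with the power of
  \<open>a v - t\<close>. Collecting terms by \<open>K = k + l\<close> assembles the geometric
  series for the new factor \<open>1 / (1 - t \<partial>_j)\<close>.\<close>

lemma source_poly_inner_integral:
  assumes f: "hom_poly {Suc v..<n} d f" and "v < j" "j < n" "0 \<le> a v"
  shows "((\<lambda>t. source_poly v d N js f (\<lambda>l. a l - t * root_vec v j l)) has_integral
     source_poly v d (Suc N) (j # js) f a) {0..a v}"
proof -
  define G where "G k l = (pderiv_at j ^^ l) (compl_op js k f) a" for k l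
  have taylor: "compl_op js k f (\<lambda>l. a l - t * root_vec v j l) = (\<Sum>l\<le>d - k. t ^ l / fact l * G k l)" for k t
  proof -
    have "compl_op js k f (\<lambda>l. a l - t * root_vec v j l) = compl_op js k f (a(j := a j + t))"
      using assms(2) by (intro hom_poly_cong_arg[OF hom_poly_compl_op[OF f]]) (auto simp: root_vec_def)
    also have "\<dots> = (\<Sum>l\<le>d - k. t ^ l / fact l * G k l)"
      unfolding G_def by (rule hom_poly_taylor[OF hom_poly_compl_op[OF f]])
    finally show ?thesis .
  qed
  have "(\<lambda>t. source_poly v d N js f (\<lambda>l. a l - t * root_vec v j l)) =
    (\<lambda>t. \<Sum>k\<le>d. \<Sum>l\<le>d - k. (a v - t) ^ (N + k) / fact (N + k) * (t ^ l / fact l) * G k l)"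
    unfolding source_poly_def taylor
    using assms(2) by (auto simp: root_vec_def sum_distrib_left mult_ac)
  moreover have "(\<dots> has_integral
     (\<Sum>k\<le>d. \<Sum>l\<le>d - k. a v ^ Suc (N + k + l) / fact (Suc (N + k + l)) * G k l)) {0..a v}"
    by (intro has_integral_sum has_integral_mult_left has_integral_Beta_fact assms(4)) auto
  moreover have "(\<Sum>k\<le>d. \<Sum>l\<le>d - k. a v ^ Suc (N + k + l) / fact (Suc (N + k + l)) * G k l) =
      source_poly v d (Suc N) (j # js) f a"
  proof -
    have "(\<Sum>k\<le>d. \<Sum>l\<le>d - k. a v ^ Suc (N + k + l) / fact (Suc (N + k + l)) * G k l) =
      (\<Sum>(k, l)\<in>(SIGMA k:{..d}. {..d - k}). a v ^ Suc (N + k + l) / fact (Suc (N + k + l)) * G k l)"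
      by (rule sum.Sigma) auto
    \<comment> \<open>The triangle of pairs \<open>(k, l)\<close> is reindexed by the total order
      \<open>K = k + l\<close>.\<close>
    also have "\<dots> = (\<Sum>(K, l)\<in>(SIGMA K:{..d}. {..K}). a v ^ (Suc N + K) / fact (Suc N + K) * G (K - l) l)"
      by (rule sum.reindex_bij_witness[where i = "\<lambda>(K, l). (K - l, l)" and j = "\<lambda>(k, l). (k + l, l)"])
        (auto simp: add.assoc)
    also have "\<dots> = (\<Sum>K\<le>d. \<Sum>l\<le>K. a v ^ (Suc N + K) / fact (Suc N + K) * G (K - l) l)"
      by (rule sum.Sigma[symmetric]) auto
    also have "\<dots> = source_poly v d (Suc N) (j # js) f a"
      unfolding source_poly_def compl_op_Cons_sum[OF hom_poly_imp_poly_fun[OF f]] G_def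
      by (simp add: sum_distrib_left)
    finally show ?thesis .
  qed
  ultimately show ?thesis by simp
qed

lemma flow_density_source_poly:
  assumes f: "hom_poly {Suc v..<n} d f" and dens: "flow_density s n v I f" and v: "s \<le> v" "v < n"
    and "finite I" "distinct es" "set es \<inter> I = {}"
    and "\<And>e. e \<in> set es \<Longrightarrow> fst e = v \<and> v < fst (snd e) \<and> fst (snd e) \<le> n"
  shows "flow_density s n v (I \<union> set es)
    (source_poly v d (length es) (filter (\<lambda>j. j < n) (map (fst \<circ> snd) es)) f)"
  using assms(5-)
proof (induction es)
  case Nil
  \<comment> \<open>With no edge inserted, only \<open>k = 0\<close> survives, with factor
    \<open>a v ^ 0 = 1\<close>.\<close>
  have "source_poly v d 0 [] f a = (\<Sum>k\<le>d. if k = 0 then f a else 0)" for a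
    unfolding source_poly_def by (intro sum.cong) auto
  then have "source_poly v d 0 [] f = f" by (auto simp: fun_eq_iff)
  then show ?case using dens by simp
next
  case (Cons e es)
  let ?js = "filter (\<lambda>j. j < n) (map (fst \<circ> snd) es)"
  obtain j k where e: "e = (v, j, k)" "v < j" "j \<le> n"
    using Cons.prems(4)[of e] by (cases e) auto
  have IH: "flow_density s n v (I \<union> set es) (source_poly v d (length es) ?js f)"
    by (rule Cons.IH) (use Cons.prems in auto)
  note hom = hom_poly_source_poly[OF f v(2)]
  have "flow_density s n v (insert (v, j, k) (I \<union> set es))
      (source_poly v d (Suc (length es)) (if j < n then j # ?js else ?js) f)"
  proof (rule flow_density_insert[OF IH])
    show "source_poly v d (length es) ?js f a = source_poly v d (length es) ?js f b"
      if "\<And>l. l \<in> {s..<n} \<Longrightarrow> a l = b l" for a b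
      using that v by (intro hom_poly_cong_arg[OF hom]) auto
    show "((\<lambda>t. source_poly v d (length es) ?js f (\<lambda>l. a l - t * root_vec v j l)) has_integral
        source_poly v d (Suc (length es)) (if j < n then j # ?js else ?js) f a) {0..a v}"
      if "\<forall>l\<in>{s..<n}. 0 \<le> a l" for a
      using that v e source_poly_sink_integral[OF f v(2), of a] source_poly_inner_integral[OF f e(2), of a]
      by (cases "j < n") auto
  qed (use Cons.prems e v in auto)
  then show ?case using e by (cases "j < n") (simp_all add: comp_def)
qed

text \<open>Edges with the same head are listed consecutively, so that for
  \<open>[2..<Suc r]\<close> the heads spell out \<open>inner_targets\<close>.\<close>

definition source_edges :: "(nat \<Rightarrow> nat) \<Rightarrow> nat list \<Rightarrow> (nat \<times> nat \<times> nat) list" where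
  "source_edges \<mu> js = concat (map (\<lambda>i. map (\<lambda>k. (1, i, k)) [1..<Suc (\<mu> i)]) js)"

lemma set_source_edges: "set (source_edges \<mu> js) = {(1, i, k) | i k. i \<in> set js \<and> 1 \<le> k \<and> k \<le> \<mu> i}"
  by (auto simp: source_edges_def image_iff)

lemma distinct_source_edges: "distinct js \<Longrightarrow> distinct (source_edges \<mu> js)"
  by (induction js) (auto simp: source_edges_def distinct_map inj_on_def simp del: upt_Suc)

lemma targets_source_edges:
  "map (fst \<circ> snd) (source_edges \<mu> js) = concat (map (\<lambda>i. replicate (\<mu> i) i) js)"
  by (induction js) (auto simp: source_edges_def map_replicate_const comp_def simp del: upt_Suc)

lemma length_source_edges: "length (source_edges \<mu> js) = (\<Sum>i\<leftarrow>js. \<mu> i)"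
  by (induction js) (auto simp: source_edges_def simp del: upt_Suc)

theorem theorem3p6:
  fixes r M M\<^sub>1 h :: nat and m :: "nat \<Rightarrow> nat \<Rightarrow> nat" and a :: "nat \<Rightarrow> real"
  assumes "2 \<le> r"
    and "\<And>i j. (i, j) \<in> pos_roots 1 (r + 1) \<Longrightarrow> 0 < m i j"
  defines "M \<equiv> (\<Sum>(i, j)\<in>pos_roots 1 (r + 1). m i j)"
    and "M\<^sub>1 \<equiv> (\<Sum>i\<in>{2..r + 1}. m 1 i)"
    and "h \<equiv> (\<Sum>(i, j)\<in>pos_roots 2 (r + 1). m i j) - (r - 1)"
  shows "nice_volume_poly 1 (r + 1) m a =
           (\<Sum>k = 0..h. a 1 ^ (M\<^sub>1 - 1 + k) / fact (M\<^sub>1 - 1 + k) *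
              P_op r m k (nice_volume_poly 2 (r + 1) m) a)
         \<and> M\<^sub>1 - 1 + h = M - r"
proof -
  define n where "n = r + 1"
  have pos: "0 < m i j" if "1 \<le> i" "i < j" "j \<le> n" for i j
    using that assms(2)[of i j] by (auto simp: pos_roots_def n_def)
  interpret one: flow_setup 1 n m by standard (auto simp: n_def intro!: pos)
  interpret two: flow_setup 2 n m by standard (use assms(1) in \<open>auto simp: n_def intro!: pos\<close>)
  have h: "card (extra_edges 2 n m) = h" and h': "(\<Sum>(i, j)\<in>pos_roots 2 n. m i j) = h + (r - 1)"
    using two.card_extra_edges unfolding h_def n_def by auto
  have M_split: "M = M\<^sub>1 + (\<Sum>(i, j)\<in>pos_roots 2 n. m i j)"
  proof -
    have fin: "finite (pos_roots 2 n)"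
      by (rule finite_subset[of _ "{2..n} \<times> {2..n}"]) (auto simp: pos_roots_def)
    have "pos_roots 1 n = Pair 1 ` {2..n} \<union> pos_roots 2 n"
      by (auto simp: pos_roots_def image_iff)
    then have "M = (\<Sum>(i, j)\<in>Pair 1 ` {2..n}. m i j) + (\<Sum>(i, j)\<in>pos_roots 2 n. m i j)"
      unfolding M_def n_def[symmetric]
      using fin by (subst sum.union_disjoint[symmetric]) (auto simp: pos_roots_def)
    then show ?thesis by (simp add: sum.reindex inj_on_def M\<^sub>1_def n_def)
  qed
  have M1_split: "M\<^sub>1 = (\<Sum>i\<in>{2..r}. m 1 i) + m 1 n"
    unfolding M\<^sub>1_def n_def using assms(1) by simp
  \<comment> \<open>Positivity here makes the truncated subtraction in \<open>M\<^sub>1 - 1\<close>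
    exact.\<close>
  have m1n: "0 < m 1 n" by (rule pos) (use assms(1) in \<open>auto simp: n_def\<close>)
  have degree: "M\<^sub>1 - 1 + h = M - r"
    unfolding M_split h' using M1_split m1n assms(1) by auto
  \<comment> \<open>The same \<open>p\<close> is used twice: with \<open>s = 2\<close> it is the
    volume polynomial of the smaller graph, with \<open>s = 1\<close> the density of the larger
    graph before the remaining edges out of vertex 1 are inserted.\<close>
  obtain p where p: "hom_poly {2..<n} h p"
    "\<And>s. s \<le> 2 \<Longrightarrow> flow_density s n 2 (sink_edges s n \<union> extra_edges 2 n m) p"
    using flow_density_exists[OF two.sn, of m] unfolding h by blast
  have "flow_density 2 n 2 two.FI p" using p(2)[of 2] two.flow_index_extra by simp
  moreover have "hom_poly {2..<n} ((\<Sum>(i, j)\<in>pos_roots 2 n. m i j) - (n - 2)) p"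
    using p(1) unfolding h' by (simp add: n_def)
  ultimately have p_eq: "nice_volume_poly 2 n m = p" by (rule two.nice_volume_poly_eq)
  \<comment> \<open>All edges out of vertex 1 still to be inserted. Those into the sink start at
    \<open>k = 2\<close>, as \<open>(1, n, 1)\<close> is present from the beginning; this accounts
    for the length \<open>M\<^sub>1 - 1\<close>.\<close>
  define es where "es = source_edges (m 1) [2..<Suc r] @ map (\<lambda>k. (1::nat, n, k)) [2..<Suc (m 1 n)]"
  have set_es: "set es = {e \<in> extra_edges 1 n m. fst e = 1}"
    using assms(1)
    by (auto simp: es_def set_source_edges extra_edges_def flow_index_def pos_roots_def n_def image_iff
        simp del: upt_Suc)
  have distinct_es: "distinct es"
    unfolding es_def
    by (auto simp: distinct_source_edges distinct_map inj_on_def set_source_edges n_def simp del: upt_Suc)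
  have targets: "filter (\<lambda>j. j < n) (map (fst \<circ> snd) es) = inner_targets r m"
    unfolding es_def map_append targets_source_edges filter_append
    by (auto simp: n_def filter_concat filter_empty_conv comp_def simp del: upt_Suc
        intro!: arg_cong[of _ _ concat])
  have length_es: "length es = M\<^sub>1 - 1"
    using m1n unfolding es_def M1_split length_append length_source_edges interv_sum_list_conv_sum_set_nat
    by (simp add: atLeastLessThanSuc_atLeastAtMost del: upt_Suc)
  let ?I = "sink_edges 1 n \<union> extra_edges 2 n m"
  have "flow_density 1 n 1 (?I \<union> set es) (source_poly 1 h (M\<^sub>1 - 1) (inner_targets r m) p)"
    unfolding targets[symmetric] length_es[symmetric]
  proof (rule flow_density_source_poly)
    show "hom_poly {Suc 1..<n} h p" using p(1) by (simp add: numeral_2_eq_2)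
    show "flow_density 1 n 1 ?I p" by (rule flow_density_mono[OF p(2)]) auto
    show "finite ?I" by (simp add: extra_edges_def finite_flow_index)
    show "set es \<inter> ?I = {}" unfolding set_es
      by (auto simp: extra_edges_def flow_index_def pos_roots_def)
  qed (use distinct_es assms(1) in \<open>auto simp: set_es n_def extra_edges_def flow_index_def pos_roots_def\<close>)
  moreover have "?I \<union> set es = one.FI"
    unfolding one.flow_index_extra set_es
    by (auto simp: extra_edges_def flow_index_def pos_roots_def)
  moreover have "hom_poly {1..<n} ((\<Sum>(i, j)\<in>pos_roots 1 n. m i j) - (n - 1))
      (source_poly 1 h (M\<^sub>1 - 1) (inner_targets r m) p)"
    using hom_poly_source_poly[of 1 n h p "M\<^sub>1 - 1" "inner_targets r m"] p(1) assms(1) degree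
    unfolding M_def n_def by (simp add: numeral_2_eq_2)
  ultimately have "nice_volume_poly 1 n m = source_poly 1 h (M\<^sub>1 - 1) (inner_targets r m) p"
    using one.nice_volume_poly_eq by metis
  then have "nice_volume_poly 1 n m a = (\<Sum>k = 0..h. a 1 ^ (M\<^sub>1 - 1 + k) / fact (M\<^sub>1 - 1 + k) *
              P_op r m k (nice_volume_poly 2 n m) a)"
    unfolding p_eq P_op_eq_compl_op[OF hom_poly_imp_poly_fun[OF p(1)]]
    by (simp add: source_poly_def atMost_atLeast0)
  then show ?thesis using degree unfolding n_def by blast
qed

end
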